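(* Let $H$ be a separable infinite-dimensional complex Hilbert space, let $M$ be an AW*-algebra, and let $\phi \colon B(H) \to M$ be a discretization of $B(H)$. Then $M = 0$.
   Context: All algebras are over $\mathbb{C}$; $B(H)$ is the C*-algebra of bounded operators on $H$. An AW*-algebra is a (unital) C*-algebra in which the right annihilator of every subset is of the form $pM$ for a projection $p$ (i.e. a C*-algebra that is a Baer $*$-ring); the zero algebra is allowed. The projections of an AW*-algebra form a complete lattice. $\mathbf{AWstar}$ denotes the category whose objects are AW*-algebras and whose morphisms are unital $*$-homomorphisms whose restriction to the projection lattices preserves arbitrary least upper bounds. For a compact Hausdorff space $X$, $C(X)$ is the C*-algebra of continuous complex functions on $X$, and $\ell^\infty(X)$ is the algebra of all bounded complex functions on the set $X$; there is a natural inclusion $C(X) \hookrightarrow \ell^\infty(X)$. Definition. A discretization of a unital C*-algebra $A$ is a unital $*$-homomorphism $\phi \colon A \to M$ to an AW*-algebra $M$ such that for each commutative unital C*-subalgebra $C \subseteq A$ (containing the unit of $A$), with $C \cong C(X)$ by Gelfand duality for a compact Hausdorff space $X$, the restriction $\phi|_C \colon C(X) \to M$ factors through the natural inclusion $C(X) \hookrightarrow \ell^\infty(X)$ via some morphism $\ell^\infty(X) \to M$ in $\mathbf{AWstar}$. *)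

theory Defs
  imports "HOL-Analysis.Analysis" "HOL-Algebra.Module" "HOL-Algebra.Subrings"
begin

section \<open>C*-algebras\<close>

text \<open>Algebras are records with an explicit carrier, so that the zero algebra, subalgebras and the
  algebras of bounded functions on arbitrary sets are all covered.\<close>

definition complex_ring :: "complex ring" where
  "complex_ring = \<lparr>carrier = UNIV, mult = (*), one = 1, zero = 0, add = (+)\<rparr>"

record 'a star_algebra = "(complex, 'a) module" +
  star :: "'a \<Rightarrow> 'a"
  alg_norm :: "'a \<Rightarrow> real"

definition norm_tendsto :: "('a, 'm) star_algebra_scheme \<Rightarrow> (nat \<Rightarrow> 'a) \<Rightarrow> 'a \<Rightarrow> bool" where
  "norm_tendsto A s x \<longleftrightarrow> (\<lambda>n. alg_norm A (s n \<ominus>\<^bsub>A\<^esub> x)) \<longlonglongrightarrow> 0"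

definition norm_Cauchy :: "('a, 'm) star_algebra_scheme \<Rightarrow> (nat \<Rightarrow> 'a) \<Rightarrow> bool" where
  "norm_Cauchy A s \<longleftrightarrow>
    (\<forall>e>0. \<exists>N. \<forall>m\<ge>N. \<forall>n\<ge>N. alg_norm A (s m \<ominus>\<^bsub>A\<^esub> s n) < e)"

locale cstar_algebra = module complex_ring A + ring A for A :: "('a, 'm) star_algebra_scheme" (structure) +
  assumes smult_mult_left:
      "\<lbrakk>x \<in> carrier A; y \<in> carrier A\<rbrakk> \<Longrightarrow> (c \<odot>\<^bsub>A\<^esub> x) \<otimes>\<^bsub>A\<^esub> y = c \<odot>\<^bsub>A\<^esub> (x \<otimes>\<^bsub>A\<^esub> y)"
    and smult_mult_right:
      "\<lbrakk>x \<in> carrier A; y \<in> carrier A\<rbrakk> \<Longrightarrow> x \<otimes>\<^bsub>A\<^esub> (c \<odot>\<^bsub>A\<^esub> y) = c \<odot>\<^bsub>A\<^esub> (x \<otimes>\<^bsub>A\<^esub> y)"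
    and star_closed: "x \<in> carrier A \<Longrightarrow> star A x \<in> carrier A"
    and star_star: "x \<in> carrier A \<Longrightarrow> star A (star A x) = x"
    and star_add:
      "\<lbrakk>x \<in> carrier A; y \<in> carrier A\<rbrakk> \<Longrightarrow> star A (x \<oplus>\<^bsub>A\<^esub> y) = star A x \<oplus>\<^bsub>A\<^esub> star A y"
    and star_mult:
      "\<lbrakk>x \<in> carrier A; y \<in> carrier A\<rbrakk> \<Longrightarrow> star A (x \<otimes>\<^bsub>A\<^esub> y) = star A y \<otimes>\<^bsub>A\<^esub> star A x"
    and star_smult: "x \<in> carrier A \<Longrightarrow> star A (c \<odot>\<^bsub>A\<^esub> x) = cnj c \<odot>\<^bsub>A\<^esub> star A x"
    and norm_nonneg: "x \<in> carrier A \<Longrightarrow> 0 \<le> alg_norm A x"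
    and norm_eq_zero_iff: "x \<in> carrier A \<Longrightarrow> alg_norm A x = 0 \<longleftrightarrow> x = \<zero>\<^bsub>A\<^esub>"
    and norm_triangle:
      "\<lbrakk>x \<in> carrier A; y \<in> carrier A\<rbrakk> \<Longrightarrow> alg_norm A (x \<oplus>\<^bsub>A\<^esub> y) \<le> alg_norm A x + alg_norm A y"
    and norm_smult: "x \<in> carrier A \<Longrightarrow> alg_norm A (c \<odot>\<^bsub>A\<^esub> x) = cmod c * alg_norm A x"
    and norm_mult:
      "\<lbrakk>x \<in> carrier A; y \<in> carrier A\<rbrakk> \<Longrightarrow> alg_norm A (x \<otimes>\<^bsub>A\<^esub> y) \<le> alg_norm A x * alg_norm A y"
    and cstar_identity: "x \<in> carrier A \<Longrightarrow> alg_norm A (star A x \<otimes>\<^bsub>A\<^esub> x) = (alg_norm A x)\<^sup>2"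
    and norm_complete:
      "\<lbrakk>range s \<subseteq> carrier A; norm_Cauchy A s\<rbrakk> \<Longrightarrow> \<exists>x\<in>carrier A. norm_tendsto A s x"

definition star_hom ::
  "('a, 'm) star_algebra_scheme \<Rightarrow> ('b, 'n) star_algebra_scheme \<Rightarrow> ('a \<Rightarrow> 'b) \<Rightarrow> bool" where
  "star_hom A B \<phi> \<longleftrightarrow> \<phi> \<in> ring_hom A B \<and>
    (\<forall>c. \<forall>x\<in>carrier A. \<phi> (c \<odot>\<^bsub>A\<^esub> x) = c \<odot>\<^bsub>B\<^esub> \<phi> x) \<and>
    (\<forall>x\<in>carrier A. \<phi> (star A x) = star B (\<phi> x))"

definition commutative_cstar_subalgebra :: "'a set \<Rightarrow> ('a, 'm) star_algebra_scheme \<Rightarrow> bool" where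
  "commutative_cstar_subalgebra C A \<longleftrightarrow> subcring C A \<and>
    (\<forall>c. \<forall>x\<in>C. c \<odot>\<^bsub>A\<^esub> x \<in> C) \<and> (\<forall>x\<in>C. star A x \<in> C) \<and>
    (\<forall>s. \<forall>x\<in>carrier A. range s \<subseteq> C \<and> norm_tendsto A s x \<longrightarrow> x \<in> C)"


section \<open>AW*-algebras\<close>

definition projections :: "('a, 'm) star_algebra_scheme \<Rightarrow> 'a set" where
  "projections A = {p \<in> carrier A. p \<otimes>\<^bsub>A\<^esub> p = p \<and> star A p = p}"

definition projection_order :: "('a, 'm) star_algebra_scheme \<Rightarrow> 'a gorder" where
  "projection_order A = \<lparr>carrier = projections A, eq = (=), le = (\<lambda>p q. p \<otimes>\<^bsub>A\<^esub> q = p)\<rparr>"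

definition right_annihilator :: "('a, 'm) star_algebra_scheme \<Rightarrow> 'a set \<Rightarrow> 'a set" where
  "right_annihilator A S = {x \<in> carrier A. \<forall>s\<in>S. s \<otimes>\<^bsub>A\<^esub> x = \<zero>\<^bsub>A\<^esub>}"

locale awstar_algebra = cstar_algebra +
  assumes right_annihilator_projection:
    "S \<subseteq> carrier A \<Longrightarrow> \<exists>p\<in>projections A. right_annihilator A S = (\<lambda>x. p \<otimes>\<^bsub>A\<^esub> x) ` carrier A"

definition awstar_morphism ::
  "('a, 'm) star_algebra_scheme \<Rightarrow> ('b, 'n) star_algebra_scheme \<Rightarrow> ('a \<Rightarrow> 'b) \<Rightarrow> bool" where
  "awstar_morphism A B \<psi> \<longleftrightarrow> awstar_algebra A \<and> awstar_algebra B \<and> star_hom A B \<psi> \<and>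
    (\<forall>S p. S \<subseteq> projections A \<and> is_lub (projection_order A) p S \<longrightarrow>
      is_lub (projection_order B) (\<psi> p) (\<psi> ` S))"


section \<open>Gelfand duality and discretizations\<close>

text \<open>The function values outside \<open>X\<close> are fixed by extensionality; \<open>insert 0\<close> makes the supremum
  norm correct for the zero algebra over the empty set.\<close>

definition l_infinity :: "'x set \<Rightarrow> ('x \<Rightarrow> complex) star_algebra" where
  "l_infinity X =
    \<lparr>carrier = {f \<in> extensional X. bounded (f ` X)},
     mult = (\<lambda>f g. \<lambda>x\<in>X. f x * g x), one = (\<lambda>x\<in>X. 1),
     zero = (\<lambda>x\<in>X. 0), add = (\<lambda>f g. \<lambda>x\<in>X. f x + g x),
     smult = (\<lambda>c f. \<lambda>x\<in>X. c * f x),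
     star = (\<lambda>f. \<lambda>x\<in>X. cnj (f x)),
     alg_norm = (\<lambda>f. Sup (insert 0 ((\<lambda>x. cmod (f x)) ` X)))\<rparr>"

definition characters :: "('a, 'm) star_algebra_scheme \<Rightarrow> 'a set \<Rightarrow> ('a \<Rightarrow> complex) set" where
  "characters A C = {\<gamma> \<in> extensional C.
    \<gamma> \<in> ring_hom (A\<lparr>carrier := C\<rparr>) complex_ring \<and> (\<forall>c. \<forall>x\<in>C. \<gamma> (c \<odot>\<^bsub>A\<^esub> x) = c * \<gamma> x)}"

text \<open>The Gelfand spectrum carries the topology of pointwise convergence on \<open>C\<close> (weak-* topology).\<close>

definition gelfand_spectrum :: "('a, 'm) star_algebra_scheme \<Rightarrow> 'a set \<Rightarrow> ('a \<Rightarrow> complex) topology" where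
  "gelfand_spectrum A C = subtopology (product_topology (\<lambda>_. euclidean) C) (characters A C)"

definition gelfand_transform ::
  "('a, 'm) star_algebra_scheme \<Rightarrow> 'a set \<Rightarrow> 'a \<Rightarrow> (('a \<Rightarrow> complex) \<Rightarrow> complex)" where
  "gelfand_transform A C c = (\<lambda>\<gamma>\<in>topspace (gelfand_spectrum A C). \<gamma> c)"

text \<open>By Gelfand duality, a commutative unital C*-subalgebra \<open>C\<close> is identified with \<open>C(X)\<close>, for
  \<open>X\<close> its spectrum, via the Gelfand transform. Composing this isomorphism with the inclusion of
  \<open>C(X)\<close> in the bounded functions on \<open>X\<close> gives the Gelfand transform regarded as a map
  into \<open>l_infinity X\<close>, through which the restriction of \<open>\<phi>\<close> has to factor.\<close>

definition discretization ::
  "('a, 'm) star_algebra_scheme \<Rightarrow> ('b, 'n) star_algebra_scheme \<Rightarrow> ('a \<Rightarrow> 'b) \<Rightarrow> bool" where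
  "discretization A M \<phi> \<longleftrightarrow> cstar_algebra A \<and> awstar_algebra M \<and> star_hom A M \<phi> \<and>
    (\<forall>C. commutative_cstar_subalgebra C A \<longrightarrow>
      (\<exists>\<psi>. awstar_morphism (l_infinity (topspace (gelfand_spectrum A C))) M \<psi> \<and>
        (\<forall>c\<in>C. \<psi> (gelfand_transform A C c) = \<phi> c)))"


section \<open>Bounded operators on a complex Hilbert space\<close>

class complex_hilbert = banach +
  fixes scaleC :: "complex \<Rightarrow> 'a \<Rightarrow> 'a"  (infixr \<open>*\<^sub>C\<close> 75)
    and cinner :: "'a \<Rightarrow> 'a \<Rightarrow> complex"
  assumes scaleC_add_right: "c *\<^sub>C (x + y) = c *\<^sub>C x + c *\<^sub>C y"
    and scaleC_add_left: "(c + d) *\<^sub>C x = c *\<^sub>C x + d *\<^sub>C x"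
    and scaleC_scaleC: "c *\<^sub>C (d *\<^sub>C x) = (c * d) *\<^sub>C x"
    and scaleC_one: "1 *\<^sub>C x = x"
    and scaleR_scaleC: "scaleR r x = complex_of_real r *\<^sub>C x"
    and cinner_commute: "cinner x y = cnj (cinner y x)"
    and cinner_add_right: "cinner x (y + z) = cinner x y + cinner x z"
    and cinner_scaleC_right: "cinner x (c *\<^sub>C y) = c * cinner x y"
    and cinner_self: "cinner x x = complex_of_real ((norm x)\<^sup>2)"

global_interpretation complex_vector: vector_space "scaleC :: complex \<Rightarrow> 'a \<Rightarrow> 'a::complex_hilbert"
  by standard (simp_all add: scaleC_add_right scaleC_add_left scaleC_scaleC scaleC_one)

definition cadjoint :: "('h::complex_hilbert \<Rightarrow> 'h) \<Rightarrow> 'h \<Rightarrow> 'h" where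
  "cadjoint T = (THE S. \<forall>x y. cinner (S x) y = cinner x (T y))"

definition bounded_operators :: "('h::complex_hilbert \<Rightarrow> 'h) star_algebra" where
  "bounded_operators =
    \<lparr>carrier = {T. bounded_linear T \<and> (\<forall>c x. T (c *\<^sub>C x) = c *\<^sub>C T x)},
     mult = (\<circ>), one = id, zero = (\<lambda>x. 0), add = (\<lambda>S T x. S x + T x),
     smult = (\<lambda>c T x. c *\<^sub>C T x), star = cadjoint, alg_norm = onorm\<rparr>"


section \<open>Bounded functions form an AW*-algebra, bounded operators a C*-algebra\<close>

lemma cring_complex: "cring complex_ring"
proof -
  have "\<exists>y. y + x = 0 \<and> x + y = 0" for x :: complex
    by (rule exI[of _ "- x"]) simp
  then show ?thesis
    by unfold_locales
      (auto simp: complex_ring_def Units_def algebra_simps)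
qed

lemma complex_ring_simps [simp]:
  "carrier complex_ring = UNIV" "mult complex_ring = (*)" "one complex_ring = 1"
  "zero complex_ring = 0" "add complex_ring = (+)"
  by (simp_all add: complex_ring_def)

lemma linf_bdd:
  assumes "bounded (f ` X)"
  shows "bdd_above (insert 0 ((\<lambda>x. cmod (f x)) ` X))"
proof -
  obtain B where "\<And>x. x \<in> X \<Longrightarrow> cmod (f x) \<le> B"
    using assms unfolding bounded_iff by auto
  then show ?thesis
    by (simp add: bdd_above_image_mono) (meson bdd_above.I2)
qed

lemma linf_upper:
  assumes "f \<in> carrier (l_infinity X)" "x \<in> X"
  shows "cmod (f x) \<le> alg_norm (l_infinity X) f"
  unfolding l_infinity_def using assms linf_bdd[of f X]
  by (auto simp: l_infinity_def intro!: cSup_upper)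

lemma linf_least:
  assumes "\<And>x. x \<in> X \<Longrightarrow> cmod (f x) \<le> B" "0 \<le> B"
  shows "alg_norm (l_infinity X) f \<le> B"
  unfolding l_infinity_def using assms by (auto intro!: cSup_least)

lemma linf_nonneg:
  assumes "f \<in> carrier (l_infinity X)"
  shows "0 \<le> alg_norm (l_infinity X) f"
  unfolding l_infinity_def using assms linf_bdd[of f X]
  by (auto simp: l_infinity_def intro!: cSup_upper)

lemma linf_carrierI:
  assumes "f \<in> extensional X" "\<And>x. x \<in> X \<Longrightarrow> cmod (f x) \<le> B"
  shows "f \<in> carrier (l_infinity X)"
  using assms unfolding l_infinity_def bounded_iff by auto

lemma linf_ext: "f \<in> carrier (l_infinity X) \<Longrightarrow> f \<in> extensional X"
  by (simp add: l_infinity_def)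

lemma linf_simps:
  "mult (l_infinity X) f g = (\<lambda>x\<in>X. f x * g x)" "one (l_infinity X) = (\<lambda>x\<in>X. 1)"
  "zero (l_infinity X) = (\<lambda>x\<in>X. 0)" "add (l_infinity X) f g = (\<lambda>x\<in>X. f x + g x)"
  "smult (l_infinity X) c f = (\<lambda>x\<in>X. c * f x)"
  "star (l_infinity X) f = (\<lambda>x\<in>X. cnj (f x))"
  by (simp_all add: l_infinity_def)

lemma linf_closed:
  assumes f: "f \<in> carrier (l_infinity X)" and g: "g \<in> carrier (l_infinity X)"
  shows "(\<lambda>x\<in>X. f x * g x) \<in> carrier (l_infinity X)"
    "(\<lambda>x\<in>X. f x + g x) \<in> carrier (l_infinity X)"
    "(\<lambda>x\<in>X. c * f x) \<in> carrier (l_infinity X)"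
    "(\<lambda>x\<in>X. - f x) \<in> carrier (l_infinity X)"
    "(\<lambda>x\<in>X. cnj (f x)) \<in> carrier (l_infinity X)"
    "(\<lambda>x\<in>X. c) \<in> carrier (l_infinity X)"
proof -
  let ?F = "alg_norm (l_infinity X) f" and ?G = "alg_norm (l_infinity X) g"
  note u = linf_upper[OF f] linf_upper[OF g] linf_nonneg[OF f] linf_nonneg[OF g]
  show "(\<lambda>x\<in>X. f x * g x) \<in> carrier (l_infinity X)"
    by (rule linf_carrierI[where B="?F * ?G"]) (auto simp: norm_mult intro!: mult_mono u)
  show "(\<lambda>x\<in>X. f x + g x) \<in> carrier (l_infinity X)"
    by (rule linf_carrierI[where B="?F + ?G"]) (auto intro!: norm_triangle_mono u)
  show "(\<lambda>x\<in>X. c * f x) \<in> carrier (l_infinity X)"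
    by (rule linf_carrierI[where B="cmod c * ?F"]) (auto simp: norm_mult intro!: mult_mono u)
  show "(\<lambda>x\<in>X. - f x) \<in> carrier (l_infinity X)"
    by (rule linf_carrierI[where B="?F"]) (auto intro!: u)
  show "(\<lambda>x\<in>X. cnj (f x)) \<in> carrier (l_infinity X)"
    by (rule linf_carrierI[where B="?F"]) (auto intro!: u)
  show "(\<lambda>x\<in>X. c) \<in> carrier (l_infinity X)"
    by (rule linf_carrierI[where B="cmod c"]) auto
qed

lemma linf_cl:
  assumes f: "f \<in> carrier (l_infinity X)"
  shows
    "(\<lambda>x\<in>X. c * f x) \<in> carrier (l_infinity X)"
    "(\<lambda>x\<in>X. - f x) \<in> carrier (l_infinity X)"
    "(\<lambda>x\<in>X. cnj (f x)) \<in> carrier (l_infinity X)"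
  using linf_closed[OF f f] by blast+

lemma linf_const: "(\<lambda>x\<in>X. c) \<in> carrier (l_infinity X)"
  by (rule linf_carrierI[where B="cmod c"]) auto

lemma linf_arb: "f \<in> carrier (l_infinity X) \<Longrightarrow> x \<notin> X \<Longrightarrow> f x = undefined"
  by (auto simp: l_infinity_def extensional_def)

lemmas linf_all = linf_simps linf_closed(1,2) linf_cl linf_const fun_eq_iff linf_arb algebra_simps

lemma linf_eqI:
  assumes "f \<in> extensional X" "g \<in> extensional X" "\<And>x. x \<in> X \<Longrightarrow> f x = g x"
  shows "f = g"
  using assms by (meson extensionalityI)

lemma linf_ring: "ring (l_infinity X)"
proof (rule ringI)
  show "abelian_group (l_infinity X)"
  proof (rule abelian_groupI)
    fix x assume x: "x \<in> carrier (l_infinity X)"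
    show "\<exists>y\<in>carrier (l_infinity X). y \<oplus>\<^bsub>l_infinity X\<^esub> x = \<zero>\<^bsub>l_infinity X\<^esub>"
      by (rule bexI[where x="\<lambda>t\<in>X. - x t"]) (auto simp: linf_all x)
  qed (auto simp: linf_all)
  show "Group.monoid (l_infinity X)"
    by unfold_locales (auto simp: linf_all)
qed (auto simp: linf_all)

lemma linf_minus:
  assumes f: "f \<in> carrier (l_infinity X)" and g: "g \<in> carrier (l_infinity X)"
  shows "f \<ominus>\<^bsub>l_infinity X\<^esub> g = (\<lambda>x\<in>X. f x - g x)"
proof -
  interpret ring "l_infinity X" by (rule linf_ring)
  have "\<ominus>\<^bsub>l_infinity X\<^esub> g = (\<lambda>x\<in>X. - g x)"
    by (rule minus_equality) (auto simp: linf_all g)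
  then show ?thesis by (auto simp: a_minus_def linf_simps)
qed

lemma linf_module: "module complex_ring (l_infinity X)"
proof (rule moduleI)
  show "cring complex_ring" by (rule cring_complex)
  show "abelian_group (l_infinity X)" using linf_ring by (rule ring.is_abelian_group)
qed (auto simp: linf_all)

lemma linf_complete:
  assumes s: "range s \<subseteq> carrier (l_infinity X)" and c: "norm_Cauchy (l_infinity X) s"
  shows "\<exists>f\<in>carrier (l_infinity X). norm_tendsto (l_infinity X) s f"
proof -
  let ?L = "l_infinity X"
  interpret ring ?L by (rule linf_ring)
  have sc: "s n \<in> carrier ?L" for n using s by auto
  have pw: "cmod (s m x - s n x) \<le> alg_norm ?L (s m \<ominus>\<^bsub>?L\<^esub> s n)" if "x \<in> X" for m n x
    using linf_upper[OF minus_closed[OF sc[of m] sc[of n]] that] that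
    by (simp add: linf_minus[OF sc sc])
  have C: "\<exists>N. \<forall>m\<ge>N. \<forall>n\<ge>N. \<forall>x\<in>X. cmod (s m x - s n x) < e" if "e > 0" for e
    using c[unfolded norm_Cauchy_def] that pw by (meson le_less_trans)
  have "Cauchy (\<lambda>n. s n x)" if "x \<in> X" for x
    unfolding Cauchy_def dist_norm using C that by meson
  then have lim: "(\<lambda>n. s n x) \<longlonglongrightarrow> lim (\<lambda>n. s n x)" if "x \<in> X" for x
    using that Cauchy_convergent convergent_LIMSEQ_iff by blast
  define f where "f = (\<lambda>x\<in>X. lim (\<lambda>n. s n x))"
  have D: "\<exists>N. \<forall>m\<ge>N. \<forall>x\<in>X. cmod (s m x - f x) \<le> e" if e: "e > 0" for e
  proof -
    obtain N where N: "\<And>m n x. m \<ge> N \<Longrightarrow> n \<ge> N \<Longrightarrow> x \<in> X \<Longrightarrow> cmod (s m x - s n x) < e"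
      using C[OF e] by blast
    have "cmod (s m x - f x) \<le> e" if "m \<ge> N" "x \<in> X" for m x
    proof (rule LIMSEQ_le_const2)
      show "(\<lambda>n. cmod (s m x - s n x)) \<longlonglongrightarrow> cmod (s m x - f x)"
        using lim[OF that(2)] that by (auto simp: f_def intro!: tendsto_intros)
      show "\<exists>K. \<forall>n\<ge>K. cmod (s m x - s n x) \<le> e" using N that by (meson less_imp_le)
    qed
    then show ?thesis by blast
  qed
  obtain N where N: "\<And>x. x \<in> X \<Longrightarrow> cmod (s N x - f x) \<le> 1" using D[of 1] by auto
  have fc: "f \<in> carrier ?L"
  proof (rule linf_carrierI[where B="alg_norm ?L (s N) + 1"])
    show "f \<in> extensional X" by (simp add: f_def)
    fix x assume x: "x \<in> X"
    have "cmod (f x) \<le> cmod (s N x) + cmod (s N x - f x)"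
      by (metis norm_triangle_sub add.commute norm_minus_commute)
    then show "cmod (f x) \<le> alg_norm ?L (s N) + 1"
      using linf_upper[OF sc[of N] x] N[OF x] by linarith
  qed
  have "(\<lambda>n. alg_norm ?L (s n \<ominus>\<^bsub>?L\<^esub> f)) \<longlonglongrightarrow> 0"
  proof (rule LIMSEQ_I)
    fix r :: real assume r: "r > 0"
    then obtain K where K: "\<And>m x. m \<ge> K \<Longrightarrow> x \<in> X \<Longrightarrow> cmod (s m x - f x) \<le> r/2"
      using D[of "r/2"] by auto
    have "norm (alg_norm ?L (s n \<ominus>\<^bsub>?L\<^esub> f) - 0) < r" if "n \<ge> K" for n
    proof -
      have "alg_norm ?L (s n \<ominus>\<^bsub>?L\<^esub> f) \<le> r/2"
        by (rule linf_least) (use K that r in \<open>auto simp: linf_minus[OF sc fc]\<close>)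
      moreover have "0 \<le> alg_norm ?L (s n \<ominus>\<^bsub>?L\<^esub> f)"
        by (rule linf_nonneg) (use sc fc in auto)
      ultimately show ?thesis using r by simp
    qed
    then show "\<exists>K. \<forall>n\<ge>K. norm (alg_norm ?L (s n \<ominus>\<^bsub>?L\<^esub> f) - 0) < r" by blast
  qed
  then show ?thesis using fc unfolding norm_tendsto_def by blast
qed

lemma linf_cstar: "cstar_algebra (l_infinity X)"
proof -
  let ?L = "l_infinity X"
  interpret module complex_ring ?L by (rule linf_module)
  interpret ring ?L by (rule linf_ring)
  note u = linf_upper linf_nonneg
  show ?thesis
  proof
    fix x assume x: "x \<in> carrier ?L"
    show "alg_norm ?L x = 0 \<longleftrightarrow> x = \<zero>\<^bsub>?L\<^esub>"
    proof
      assume "alg_norm ?L x = 0"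
      then have "x t = 0" if "t \<in> X" for t using linf_upper[OF x that] by simp
      then show "x = \<zero>\<^bsub>?L\<^esub>" using x by (auto simp: linf_all)
    next
      assume "x = \<zero>\<^bsub>?L\<^esub>"
      then have "alg_norm ?L x \<le> 0" by (intro linf_least) (auto simp: linf_simps)
      then show "alg_norm ?L x = 0" using linf_nonneg[OF x] by simp
    qed
    show "alg_norm ?L (c \<odot>\<^bsub>?L\<^esub> x) = cmod c * alg_norm ?L x" for c
    proof (rule antisym)
      have le: "alg_norm ?L (c \<odot>\<^bsub>?L\<^esub> x) \<le> cmod c * alg_norm ?L x"
        if "x \<in> carrier ?L" for x c
        by (rule linf_least) (auto simp: linf_simps norm_mult linf_nonneg[OF that] intro!: mult_left_mono linf_upper[OF that])
      show "alg_norm ?L (c \<odot>\<^bsub>?L\<^esub> x) \<le> cmod c * alg_norm ?L x" by (rule le[OF x])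
      show "cmod c * alg_norm ?L x \<le> alg_norm ?L (c \<odot>\<^bsub>?L\<^esub> x)"
      proof (cases "c = 0")
        case True
        then show ?thesis using linf_nonneg[of "c \<odot>\<^bsub>?L\<^esub> x" X] x by auto
      next
        case False
        have cx: "c \<odot>\<^bsub>?L\<^esub> x \<in> carrier ?L" using x by auto
        have "inverse c \<odot>\<^bsub>?L\<^esub> (c \<odot>\<^bsub>?L\<^esub> x) = x"
          using False x by (auto simp: linf_simps fun_eq_iff linf_arb)
        then have "alg_norm ?L x \<le> inverse (cmod c) * alg_norm ?L (c \<odot>\<^bsub>?L\<^esub> x)"
          using le[OF cx, of "inverse c"] by (simp add: norm_inverse)
        then show ?thesis using False by (simp add: field_simps)
      qed
    qed
    show "alg_norm ?L (star ?L x \<otimes>\<^bsub>?L\<^esub> x) = (alg_norm ?L x)\<^sup>2"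
    proof (rule antisym)
      have c: "star ?L x \<otimes>\<^bsub>?L\<^esub> x \<in> carrier ?L"
        using x by (auto simp: linf_simps(6) linf_cl)
      show "alg_norm ?L (star ?L x \<otimes>\<^bsub>?L\<^esub> x) \<le> (alg_norm ?L x)\<^sup>2"
        by (rule linf_least)
          (auto simp: linf_simps norm_mult power2_eq_square linf_nonneg[OF x] intro!: mult_mono linf_upper[OF x])
      have "alg_norm ?L x \<le> sqrt (alg_norm ?L (star ?L x \<otimes>\<^bsub>?L\<^esub> x))"
      proof (rule linf_least)
        fix t assume t: "t \<in> X"
        show "cmod (x t) \<le> sqrt (alg_norm ?L (star ?L x \<otimes>\<^bsub>?L\<^esub> x))"
          using linf_upper[OF c t] t by (intro real_le_rsqrt) (auto simp: linf_simps norm_mult power2_eq_square)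
      qed (use linf_nonneg[OF c] in simp)
      then show "(alg_norm ?L x)\<^sup>2 \<le> alg_norm ?L (star ?L x \<otimes>\<^bsub>?L\<^esub> x)"
        using linf_nonneg[OF c] linf_nonneg[OF x]
        by (metis power_mono real_sqrt_pow2)
    qed
    show "0 \<le> alg_norm ?L x" by (rule linf_nonneg[OF x])
    fix y assume y: "y \<in> carrier ?L"
    show "alg_norm ?L (x \<oplus>\<^bsub>?L\<^esub> y) \<le> alg_norm ?L x + alg_norm ?L y"
      by (rule linf_least) (auto simp: linf_simps linf_nonneg x y intro!: norm_triangle_mono linf_upper)
    show "alg_norm ?L (x \<otimes>\<^bsub>?L\<^esub> y) \<le> alg_norm ?L x * alg_norm ?L y"
      by (rule linf_least) (auto simp: linf_simps norm_mult linf_nonneg x y intro!: mult_mono linf_upper)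
  next
    fix s assume "range s \<subseteq> carrier ?L" "norm_Cauchy ?L s"
    then show "\<exists>x\<in>carrier ?L. norm_tendsto ?L s x" by (rule linf_complete)
  qed (auto simp: linf_all)
qed

lemma linf_awstar: "awstar_algebra (l_infinity X)"
proof -
  let ?L = "l_infinity X"
  interpret cstar_algebra ?L by (rule linf_cstar)
  show ?thesis
  proof
    fix S assume S: "S \<subseteq> carrier ?L"
    define Z where "Z = {x \<in> X. \<forall>s\<in>S. s x = 0}"
    define p :: "'a \<Rightarrow> complex" where "p = (\<lambda>x\<in>X. if x \<in> Z then 1 else 0)"
    have pc: "p \<in> carrier ?L" by (rule linf_carrierI[where B=1]) (auto simp: p_def)
    have p: "p \<in> projections ?L"
      using pc by (auto simp: projections_def linf_simps p_def fun_eq_iff)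
    have "right_annihilator ?L S = (\<lambda>x. p \<otimes>\<^bsub>?L\<^esub> x) ` carrier ?L"
    proof (intro equalityI subsetI)
      fix f assume f: "f \<in> right_annihilator ?L S"
      then have fc: "f \<in> carrier ?L" and z0: "\<And>s. s \<in> S \<Longrightarrow> (\<lambda>x\<in>X. s x * f x) = (\<lambda>x\<in>X. 0)"
        unfolding right_annihilator_def linf_simps by auto
      have z: "s x * f x = 0" if "s \<in> S" "x \<in> X" for s x
        using fun_cong[OF z0[OF that(1)], of x] that(2) by simp
      have "f = p \<otimes>\<^bsub>?L\<^esub> f"
        using fc z by (auto simp: linf_simps p_def Z_def fun_eq_iff linf_arb)
      then show "f \<in> (\<lambda>x. p \<otimes>\<^bsub>?L\<^esub> x) ` carrier ?L" using fc by blast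
    next
      fix f assume "f \<in> (\<lambda>x. p \<otimes>\<^bsub>?L\<^esub> x) ` carrier ?L"
      then obtain g where g: "g \<in> carrier ?L" "f = p \<otimes>\<^bsub>?L\<^esub> g" by blast
      have "p \<otimes>\<^bsub>?L\<^esub> g \<in> carrier ?L" using pc g by auto
      moreover have "s \<otimes>\<^bsub>?L\<^esub> (p \<otimes>\<^bsub>?L\<^esub> g) = \<zero>\<^bsub>?L\<^esub>" if "s \<in> S" for s
        using that by (auto simp: linf_simps p_def Z_def fun_eq_iff)
      ultimately show "f \<in> right_annihilator ?L S"
        unfolding g(2) right_annihilator_def by blast
    qed
    then show "\<exists>p\<in>projections ?L. right_annihilator ?L S = (\<lambda>x. p \<otimes>\<^bsub>?L\<^esub> x) ` carrier ?L"
      using p by blast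
  qed
qed

lemma cinner_add_left: "cinner (x + y) z = cinner x z + cinner (y::'a::complex_hilbert) z"
  by (metis cinner_add_right cinner_commute complex_cnj_add)

lemma cinner_scaleC_left: "cinner (c *\<^sub>C x) y = cnj c * cinner (x::'a::complex_hilbert) y"
  by (metis cinner_scaleC_right cinner_commute complex_cnj_mult)

lemma cinner_zero [simp]: "cinner (0::'a::complex_hilbert) y = 0" "cinner x (0::'a::complex_hilbert) = 0"
  using cinner_add_left[of 0 0 y] cinner_add_right[of x 0 0] by auto

lemma cinner_minus_left: "cinner (- x) y = - cinner (x::'a::complex_hilbert) y"
  using cinner_add_left[of x "- x" y] by (simp add: eq_neg_iff_add_eq_0 add.commute)

lemma cinner_minus_right: "cinner x (- y) = - cinner (x::'a::complex_hilbert) y"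
  using cinner_add_right[of x y "- y"] by (simp add: eq_neg_iff_add_eq_0 add.commute)

lemma cinner_diff_left: "cinner (x - y) z = cinner x z - cinner (y::'a::complex_hilbert) z"
  by (metis cinner_add_left cinner_minus_left diff_conv_add_uminus)

lemma cinner_diff_right: "cinner z (x - y) = cinner z x - cinner z (y::'a::complex_hilbert)"
  by (metis cinner_add_right cinner_minus_right diff_conv_add_uminus)

lemma cinner_ext: "(\<And>y. cinner x y = cinner x' y) \<Longrightarrow> x = (x'::'a::complex_hilbert)"
proof -
  assume "\<And>y. cinner x y = cinner x' y"
  then have "cinner (x - x') (x - x') = 0" by (simp add: cinner_diff_left)
  then show ?thesis by (simp add: cinner_self)
qed

lemma norm_scaleC: "norm (c *\<^sub>C x) = cmod c * norm (x::'a::complex_hilbert)"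
proof -
  have "complex_of_real ((norm (c *\<^sub>C x))\<^sup>2) = complex_of_real ((cmod c * norm x)\<^sup>2)"
    by (simp only: cinner_self[symmetric] cinner_scaleC_left cinner_scaleC_right)
      (use complex_norm_square[of c] in \<open>simp add: cinner_self power_mult_distrib mult.commute mult.left_commute\<close>)
  then have "(norm (c *\<^sub>C x))\<^sup>2 = (cmod c * norm x)\<^sup>2" by (simp only: of_real_eq_iff)
  then show ?thesis by simp
qed

lemma norm_add_sq: "(norm (x + y))\<^sup>2 = (norm x)\<^sup>2 + (norm y)\<^sup>2 + 2 * Re (cinner x (y::'a::complex_hilbert))"
proof -
  have "complex_of_real ((norm (x + y))\<^sup>2) = cinner x x + cinner y y + (cinner x y + cnj (cinner x y))"
    unfolding cinner_self[symmetric] cinner_add_left cinner_add_right cinner_commute[symmetric] by simp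
  also have "\<dots> = complex_of_real ((norm x)\<^sup>2 + (norm y)\<^sup>2 + 2 * Re (cinner x y))"
    by (simp add: cinner_self complex_add_cnj)
  finally show ?thesis by (simp only: of_real_eq_iff)
qed

lemma cauchy_schwarz: "cmod (cinner x y) \<le> norm x * norm (y::'a::complex_hilbert)"
proof (cases "x = 0")
  case False
  define c where "c = cinner x y"
  define n where "n = (norm x)\<^sup>2"
  have n: "n > 0" using False by (simp add: n_def)
  have yx: "cinner y x = cnj c" unfolding c_def by (rule cinner_commute)
  define a where "a = - (c / complex_of_real n)"
  have "a * cnj c = complex_of_real (- ((cmod c)\<^sup>2 / n))"
    using complex_norm_square[of c] by (simp add: a_def)
  then have ra: "Re (a * cnj c) = - ((cmod c)\<^sup>2 / n)" by (simp only: Re_complex_of_real)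
  have na: "(cmod a)\<^sup>2 = (cmod c)\<^sup>2 / n\<^sup>2" using n by (simp add: a_def norm_divide power_divide)
  have "0 \<le> (norm (y + a *\<^sub>C x))\<^sup>2" by simp
  also have "\<dots> = (norm y)\<^sup>2 + (cmod a)\<^sup>2 * n + 2 * Re (a * cnj c)"
    unfolding norm_add_sq norm_scaleC cinner_scaleC_right yx n_def power_mult_distrib by simp
  also have "\<dots> = (norm y)\<^sup>2 - (cmod c)\<^sup>2 / n"
    unfolding ra na using n by (simp add: power2_eq_square)
  finally have "(cmod c)\<^sup>2 \<le> (norm y)\<^sup>2 * n" using n by (simp add: divide_le_eq)
  then have "(cmod c)\<^sup>2 \<le> (norm x * norm y)\<^sup>2" by (simp add: n_def power_mult_distrib mult.commute)
  then show ?thesis unfolding c_def by (rule power2_le_imp_le) simp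
qed simp

text \<open>The representing vector minimises \<open>(norm x)\<^sup>2 - 2 * Re (f x)\<close>.\<close>

lemma riesz:
  fixes f :: "'a::complex_hilbert \<Rightarrow> complex"
  assumes add: "\<And>x y. f (x + y) = f x + f y" and sc: "\<And>c x. f (c *\<^sub>C x) = c * f x"
    and bd: "\<And>x. cmod (f x) \<le> K * norm x"
  shows "\<exists>y. \<forall>x. f x = cinner y x"
proof -
  define Q where "Q = (\<lambda>x. (norm x)\<^sup>2 - 2 * Re (f x))"
  have lower: "- K\<^sup>2 \<le> Q x" for x
  proof -
    have "Re (f x) \<le> K * norm x" using bd[of x] complex_Re_le_cmod[of "f x"] by linarith
    moreover have "0 \<le> (norm x - K)\<^sup>2" by simp
    ultimately show ?thesis unfolding Q_def by (simp add: power2_eq_square algebra_simps)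
  qed
  define m where "m = (INF x. Q x)"
  have bb: "bdd_below (range Q)" using lower by (meson bdd_belowI2)
  have m: "m \<le> Q x" for x unfolding m_def using bb by (simp add: cINF_lower)
  have "\<exists>x. Q x < m + 1 / real (Suc n)" for n
    using cINF_less_iff[of UNIV Q "m + 1 / real (Suc n)"] bb by (simp add: m_def)
  then obtain s where s: "\<And>n. Q (s n) < m + 1 / real (Suc n)" by metis
  have par: "(norm (x - y))\<^sup>2 = 2 * Q x + 2 * Q y - 4 * Q ((1/2) *\<^sub>R (x + y))" for x y
  proof -
    have f2: "f ((1/2) *\<^sub>R (x + y)) = (f x + f y) / 2"
      by (simp add: scaleR_scaleC sc add)
    have n1: "(norm (x - y))\<^sup>2 = (norm x)\<^sup>2 + (norm y)\<^sup>2 - 2 * Re (cinner x y)"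
      using norm_add_sq[of x "- y"] by (simp add: cinner_minus_right)
    have n2: "(norm ((1/2) *\<^sub>R (x + y)))\<^sup>2 = (norm (x + y))\<^sup>2 / 4" by (simp add: power_divide)
    have n3: "Re ((f x + f y) / 2) = (Re (f x) + Re (f y)) / 2" by simp
    show ?thesis
      unfolding Q_def f2 n1 n2 n3 norm_add_sq[of x y] by (simp add: field_simps)
  qed
  have close: "(norm (s i - s j))\<^sup>2 \<le> 4 / real (Suc N)" if "i \<ge> N" "j \<ge> N" for i j N
  proof -
    have "1 / real (Suc i) \<le> 1 / real (Suc N)" "1 / real (Suc j) \<le> 1 / real (Suc N)"
      using that by (auto intro!: divide_left_mono)
    then show ?thesis
      using par[of "s i" "s j"] s[of i] s[of j] m[of "(1/2) *\<^sub>R (s i + s j)"] by linarith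
  qed
  have "Cauchy s"
  proof (rule metric_CauchyI)
    fix e :: real assume e: "0 < e"
    obtain N where N: "4 / e\<^sup>2 < real N" using reals_Archimedean2 by blast
    then have "4 / real (Suc N) < e\<^sup>2" using e
    proof -
      have "4 < real N * e\<^sup>2" using N e by (simp add: divide_less_eq)
      also have "\<dots> \<le> real (Suc N) * e\<^sup>2" by (intro mult_right_mono) auto
      finally show ?thesis by (simp add: divide_less_eq mult.commute)
    qed
    then have "dist (s i) (s j) < e" if "i \<ge> N" "j \<ge> N" for i j
      unfolding dist_norm
      by (rule power2_less_imp_less[OF le_less_trans[OF close[OF that]]]) (use e in simp)
    then show "\<exists>M. \<forall>i\<ge>M. \<forall>j\<ge>M. dist (s i) (s j) < e" by blast
  qed
  then obtain y where y: "s \<longlonglongrightarrow> y" using Cauchy_convergent convergent_def by blast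
  have bl: "bounded_linear f"
    by (rule bounded_linear_intro[where K=K]) (auto simp: add scaleR_scaleC sc bd mult.commute scaleR_conv_of_real)
  have "(\<lambda>n. Q (s n)) \<longlonglongrightarrow> Q y"
    unfolding Q_def by (intro tendsto_intros y bounded_linear.tendsto[OF bl])
  moreover have "(\<lambda>n. m + 1 / real (Suc n)) \<longlonglongrightarrow> m + 0"
    by (intro tendsto_intros LIMSEQ_Suc lim_1_over_n)
  ultimately have "Q y \<le> m + 0" by (rule LIMSEQ_le) (use s in \<open>auto intro: less_imp_le\<close>)
  then have min: "Q y \<le> Q x" for x using m[of x] by simp
  have re: "Re (cinner y h) = Re (f h)" for h
  proof -
    define d where "d = Re (cinner y h) - Re (f h)"
    have "0 \<le> t\<^sup>2 * (norm h)\<^sup>2 + 2 * t * d" for t :: real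
    proof -
      have "Q (y + t *\<^sub>R h) = Q y + t\<^sup>2 * (norm h)\<^sup>2 + 2 * t * d"
        unfolding Q_def d_def norm_add_sq
        by (simp add: scaleR_scaleC add sc cinner_scaleC_right norm_scaleC power_mult_distrib algebra_simps)
      then show ?thesis using min[of "y + t *\<^sub>R h"] by simp
    qed
    from this[of "- d / ((norm h)\<^sup>2 + 1)"]
    have "0 \<le> d\<^sup>2 * (norm h)\<^sup>2 / ((norm h)\<^sup>2 + 1)\<^sup>2 - 2 * d\<^sup>2 / ((norm h)\<^sup>2 + 1)"
      by (simp add: power_divide power2_eq_square)
    moreover have "d\<^sup>2 * (norm h)\<^sup>2 / ((norm h)\<^sup>2 + 1)\<^sup>2 \<le> d\<^sup>2 / ((norm h)\<^sup>2 + 1)"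
    proof -
      have "d\<^sup>2 * ((norm h)\<^sup>2 / ((norm h)\<^sup>2 + 1)) / ((norm h)\<^sup>2 + 1) \<le> d\<^sup>2 * 1 / ((norm h)\<^sup>2 + 1)"
        by (intro divide_right_mono mult_left_mono) (auto simp: divide_le_eq_1 add_nonneg_pos)
      then show ?thesis by (simp add: power2_eq_square)
    qed
    ultimately have "d\<^sup>2 / ((norm h)\<^sup>2 + 1) \<le> 0" by simp
    moreover have "(norm h)\<^sup>2 + 1 > 0" by (simp add: add_nonneg_pos)
    ultimately have "d\<^sup>2 \<le> 0" by (simp add: divide_le_0_iff)
    then show ?thesis by (simp add: d_def)
  qed
  have "f h = cinner y h" for h
  proof (rule complex_eqI)
    show "Re (f h) = Re (cinner y h)" using re[of h] by simp
    show "Im (f h) = Im (cinner y h)" using re[of "\<i> *\<^sub>C h"] by (simp add: sc cinner_scaleC_right)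
  qed
  then show ?thesis by blast
qed

abbreviation (input) "BH \<equiv> bounded_operators :: ('h::complex_hilbert \<Rightarrow> 'h) star_algebra"

lemma adj_ex:
  assumes T: "T \<in> carrier BH"
  shows "\<forall>x y. cinner (cadjoint T x) y = cinner x (T y)"
proof -
  have bl: "bounded_linear T" and c: "\<And>c x. T (c *\<^sub>C x) = c *\<^sub>C T x"
    using T by (auto simp: bounded_operators_def)
  have "\<exists>z. \<forall>y. cinner x (T y) = cinner z y" for x
  proof (rule riesz[where K="norm x * onorm T"])
    show "cinner x (T (u + v)) = cinner x (T u) + cinner x (T v)" for u v
      by (simp add: bounded_linear.linear[OF bl] linear_add cinner_add_right)
    show "cmod (cinner x (T u)) \<le> norm x * onorm T * norm u" for u
      using cauchy_schwarz[of x "T u"] mult_left_mono[OF onorm[OF bl, of u], of "norm x"]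
      by (simp add: mult.assoc)
  qed (simp add: c cinner_scaleC_right)
  then obtain S where S: "\<And>x y. cinner x (T y) = cinner (S x) y" by metis
  show ?thesis unfolding cadjoint_def
  proof (rule theI2[where a=S])
    show "R = S" if "\<forall>x y. cinner (R x) y = cinner x (T y)" for R
      by (rule ext, rule cinner_ext) (simp add: that S)
  qed (auto simp: S)
qed

lemma adj_eq: "(\<And>x y. cinner (S x) y = cinner x (T y)) \<Longrightarrow> T \<in> carrier BH \<Longrightarrow> cadjoint T = S"
  by (rule ext, rule cinner_ext) (simp add: adj_ex)

lemma adj_carrier:
  assumes T: "T \<in> carrier BH" shows "cadjoint T \<in> carrier BH" "onorm (cadjoint T) \<le> onorm T"
proof -
  note a = adj_ex[OF T, rule_format]
  have bl: "bounded_linear T" using T by (simp add: bounded_operators_def)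
  have add: "cadjoint T (x + y) = cadjoint T x + cadjoint T y" for x y
    by (rule cinner_ext) (simp add: a cinner_add_left)
  have sc: "cadjoint T (c *\<^sub>C x) = c *\<^sub>C cadjoint T x" for c x
    by (rule cinner_ext) (simp add: a cinner_scaleC_left)
  have bd: "norm (cadjoint T x) \<le> onorm T * norm x" for x
  proof (cases "cadjoint T x = 0")
    case False
    have "(norm (cadjoint T x))\<^sup>2 = cmod (cinner (cadjoint T x) (cadjoint T x))"
      by (simp add: cinner_self norm_power)
    also have "\<dots> = cmod (cinner x (T (cadjoint T x)))" by (simp add: a)
    also have "\<dots> \<le> norm x * norm (T (cadjoint T x))" by (rule cauchy_schwarz)
    also have "\<dots> \<le> norm x * (onorm T * norm (cadjoint T x))" by (intro mult_left_mono onorm bl) simp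
    finally show ?thesis using False by (simp add: power2_eq_square mult.commute mult.left_commute)
  qed (simp add: onorm_pos_le[OF bl])
  show "cadjoint T \<in> carrier BH"
    unfolding bounded_operators_def
    by (auto simp: sc scaleR_scaleC add bd mult.commute intro!: bounded_linear_intro[where K="onorm T"])
  show "onorm (cadjoint T) \<le> onorm T" by (rule onorm_bound) (use bd onorm_pos_le[OF bl] in auto)
qed

lemma bop_simps:
  "mult BH = (\<circ>)" "one BH = id" "zero BH = (\<lambda>x. 0)" "add BH = (\<lambda>S T x. S x + T x)"
  "smult BH = (\<lambda>c T x. c *\<^sub>C T x)" "star BH = cadjoint" "alg_norm BH = onorm"
  by (simp_all add: bounded_operators_def)

lemma bop_carrier: "T \<in> carrier BH \<longleftrightarrow> bounded_linear T \<and> (\<forall>c x. T (c *\<^sub>C x) = c *\<^sub>C T x)"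
  by (simp add: bounded_operators_def)

lemma bop_bl: "T \<in> carrier BH \<Longrightarrow> bounded_linear T"
  and bop_c: "T \<in> carrier BH \<Longrightarrow> T (c *\<^sub>C x) = c *\<^sub>C T x"
  and bop_add: "T \<in> carrier BH \<Longrightarrow> T (x + y) = T x + T y"
  and bop_zero: "T \<in> carrier BH \<Longrightarrow> T 0 = 0"
  by (auto simp: bop_carrier bounded_linear.linear linear_add linear_0)

lemma bl_scaleC: "bounded_linear (\<lambda>x. c *\<^sub>C (x::'h::complex_hilbert))"
  by (rule bounded_linear_intro[where K="cmod c"])
    (auto simp: scaleC_add_right scaleR_scaleC scaleC_scaleC norm_scaleC mult.commute)

lemma scaleC_zero [simp]: "c *\<^sub>C (0::'h::complex_hilbert) = 0" "0 *\<^sub>C (x::'h::complex_hilbert) = 0"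
  using scaleC_add_right[of c 0 0] scaleC_add_left[of 0 0 x] by auto

lemma scaleC_minus: "c *\<^sub>C (- x::'h::complex_hilbert) = - (c *\<^sub>C x)"
  by (metis add_eq_0_iff2 scaleC_add_right scaleC_zero(1) add.left_inverse)

lemma bop_closed:
  "S \<in> carrier BH \<Longrightarrow> T \<in> carrier BH \<Longrightarrow> S \<circ> T \<in> carrier BH"
  "S \<in> carrier BH \<Longrightarrow> T \<in> carrier BH \<Longrightarrow> (\<lambda>x. S x + T x) \<in> carrier BH"
  "S \<in> carrier BH \<Longrightarrow> (\<lambda>x. c *\<^sub>C S x) \<in> carrier BH"
  "S \<in> carrier BH \<Longrightarrow> (\<lambda>x. - S x) \<in> carrier BH"
  "id \<in> carrier BH" "(\<lambda>x. 0) \<in> carrier BH"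
  unfolding bop_carrier
  by (auto simp: o_def id_def scaleC_add_right scaleC_scaleC scaleC_minus mult.commute
      intro: bounded_linear_compose bounded_linear_add bounded_linear_minus bounded_linear_ident bounded_linear_zero
       bounded_linear_compose[OF bl_scaleC])

lemmas bop_all = bop_simps bop_closed bop_add bop_c bop_zero adj_carrier(1) fun_eq_iff algebra_simps
   scaleC_add_right scaleC_add_left scaleC_scaleC scaleC_one

lemma bop_ring: "ring (BH :: ('a::complex_hilbert \<Rightarrow> 'a) star_algebra)"
proof (rule ringI)
  show "abelian_group (BH :: ('a::complex_hilbert \<Rightarrow> 'a) star_algebra)"
  proof (rule abelian_groupI)
    fix x :: "'a \<Rightarrow> 'a" assume x: "x \<in> carrier BH"
    show "\<exists>y\<in>carrier BH. y \<oplus>\<^bsub>BH\<^esub> x = \<zero>\<^bsub>BH\<^esub>"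
      by (rule bexI[where x="\<lambda>t. - x t"]) (auto simp: bop_all x)
  qed (auto simp: bop_all)
  show "Group.monoid (BH :: ('a::complex_hilbert \<Rightarrow> 'a) star_algebra)"
    by unfold_locales (auto simp: bop_all)
qed (auto simp: bop_all)

lemma bop_minus:
  assumes f: "f \<in> carrier BH" and g: "g \<in> carrier BH"
  shows "f \<ominus>\<^bsub>BH\<^esub> g = (\<lambda>x. f x - g x)"
proof -
  interpret ring BH by (rule bop_ring)
  have "\<ominus>\<^bsub>BH\<^esub> g = (\<lambda>x. - g x)"
    by (rule minus_equality) (auto simp: bop_all g)
  then show ?thesis by (auto simp: a_minus_def bop_simps)
qed

lemma bop_module: "module complex_ring (BH :: ('a::complex_hilbert \<Rightarrow> 'a) star_algebra)"
proof (rule moduleI)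
  show "cring complex_ring" by (rule cring_complex)
  show "abelian_group (BH :: ('a::complex_hilbert \<Rightarrow> 'a) star_algebra)" using bop_ring by (rule ring.is_abelian_group)
qed (auto simp: bop_all complex_ring_def)

lemma bop_complete:
  fixes s :: "nat \<Rightarrow> 'h::complex_hilbert \<Rightarrow> 'h"
  assumes s: "range s \<subseteq> carrier BH" and c: "norm_Cauchy BH s"
  shows "\<exists>f\<in>carrier BH. norm_tendsto BH s f"
proof -
  have sc: "s n \<in> carrier BH" for n using s by auto
  have bl: "bounded_linear (s n)" for n using bop_bl[OF sc] .
  define b where "b = (\<lambda>n. Blinfun (s n))"
  have ap: "blinfun_apply (b n) = s n" for n by (simp add: b_def bounded_linear_Blinfun_apply bl)
  have nd: "norm (b m - B) = onorm (\<lambda>x. s m x - blinfun_apply B x)" for m B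
    by (simp add: norm_blinfun.rep_eq minus_blinfun.rep_eq ap)
  have "Cauchy b"
    unfolding Cauchy_def dist_norm
    using c unfolding norm_Cauchy_def by (simp add: nd bop_minus[OF sc sc] bop_simps ap)
  then obtain B where B: "b \<longlonglongrightarrow> B" using Cauchy_convergent convergent_def by blast
  have pw: "(\<lambda>n. s n x) \<longlonglongrightarrow> blinfun_apply B x" for x
    using blinfun.tendsto[OF B tendsto_const[of x]] by (simp add: ap)
  have "blinfun_apply B (c *\<^sub>C x) = c *\<^sub>C blinfun_apply B x" for c x
    using pw[of "c *\<^sub>C x"] bounded_linear.tendsto[OF bl_scaleC pw[of x], of c]
    by (simp add: bop_c[OF sc] LIMSEQ_unique)
  then have Bc: "blinfun_apply B \<in> carrier BH" by (simp add: bop_carrier blinfun.bounded_linear_right)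
  have "(\<lambda>n. norm (b n - B)) \<longlonglongrightarrow> 0" using B by (simp add: LIM_zero tendsto_norm_zero)
  then have "norm_tendsto BH s (blinfun_apply B)"
    unfolding norm_tendsto_def by (simp add: nd bop_minus[OF sc Bc] bop_simps)
  then show ?thesis using Bc by blast
qed

lemma bop_cstar: "cstar_algebra (BH :: ('a::complex_hilbert \<Rightarrow> 'a) star_algebra)"
proof -
  interpret module complex_ring BH by (rule bop_module)
  interpret ring BH by (rule bop_ring)
  show ?thesis
  proof
    fix x :: "'a \<Rightarrow> 'a" assume x: "x \<in> carrier BH"
    show "star BH (star BH x) = x"
      unfolding bop_simps
      by (rule adj_eq) (auto simp: adj_carrier x, metis adj_ex[OF x] cinner_commute)
    show "star BH (c \<odot>\<^bsub>BH\<^esub> x) = cnj c \<odot>\<^bsub>BH\<^esub> star BH x" for c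
      unfolding bop_simps
      by (rule adj_eq) (auto simp: bop_closed x adj_ex cinner_scaleC_left cinner_scaleC_right)
    show "0 \<le> alg_norm BH x" by (simp add: bop_simps onorm_pos_le bop_bl[OF x])
    show "alg_norm BH x = 0 \<longleftrightarrow> x = \<zero>\<^bsub>BH\<^esub>" by (simp add: bop_simps onorm_eq_0[OF bop_bl[OF x]] fun_eq_iff)
    show "alg_norm BH (c \<odot>\<^bsub>BH\<^esub> x) = cmod c * alg_norm BH x" for c
      unfolding bop_simps onorm_def
    proof -
      have le: "onorm (\<lambda>t. c *\<^sub>C x t) \<le> cmod c * onorm x" if "x \<in> carrier BH" for c and x :: "'a \<Rightarrow> 'a"
        by (rule onorm_bound)
          (auto simp: onorm_pos_le bop_bl[OF that] norm_scaleC mult.assoc intro!: mult_left_mono onorm)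
      have "onorm (\<lambda>t. c *\<^sub>C x t) = cmod c * onorm x"
      proof (cases "c = 0")
        case True then show ?thesis by (simp add: onorm_zero)
      next
        case False
        have "onorm x \<le> inverse (cmod c) * onorm (\<lambda>t. c *\<^sub>C x t)"
          using le[OF bop_closed(3)[OF x], of "inverse c" c] False
          by (simp add: scaleC_scaleC scaleC_one norm_inverse)
        then show ?thesis using le[OF x, of c] False by (simp add: field_simps)
      qed
      then show "(SUP t. norm (c *\<^sub>C x t) / norm t) = cmod c * (SUP t. norm (x t) / norm t)"
        by (simp add: onorm_def)
    qed
    show "alg_norm BH (star BH x \<otimes>\<^bsub>BH\<^esub> x) = (alg_norm BH x)\<^sup>2"
      unfolding bop_simps
    proof (rule antisym)
      note a = adj_carrier[OF x] bop_bl[OF x] bop_bl[OF adj_carrier(1)[OF x]]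
      have "onorm (cadjoint x \<circ> x) \<le> onorm (cadjoint x) * onorm x"
        by (rule onorm_compose) (use a in auto)
      also have "\<dots> \<le> onorm x * onorm x"
        using a by (intro mult_right_mono) (auto simp: onorm_pos_le)
      finally show "onorm (cadjoint x \<circ> x) \<le> (onorm x)\<^sup>2" by (simp add: power2_eq_square)
      have b2: "bounded_linear (cadjoint x \<circ> x)" using bop_bl[OF bop_closed(1)[OF a(1) x]] .
      have "onorm x \<le> sqrt (onorm (cadjoint x \<circ> x))"
      proof (rule onorm_bound)
        fix t
        have "(norm (x t))\<^sup>2 = cmod (cinner (cadjoint x (x t)) t)"
          by (simp add: adj_ex[OF x, rule_format] cinner_self norm_power)
        also have "\<dots> \<le> norm (cadjoint x (x t)) * norm t" by (rule cauchy_schwarz)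
        also have "\<dots> \<le> (onorm (cadjoint x \<circ> x) * norm t) * norm t"
          using onorm[OF b2, of t] by (intro mult_right_mono) auto
        also have "\<dots> = (sqrt (onorm (cadjoint x \<circ> x)) * norm t)\<^sup>2"
          using onorm_pos_le[OF b2] by (simp add: power2_eq_square)
        finally show "norm (x t) \<le> sqrt (onorm (cadjoint x \<circ> x)) * norm t"
          by (rule power2_le_imp_le) (simp add: onorm_pos_le[OF b2])
      qed (simp add: onorm_pos_le[OF b2])
      then show "(onorm x)\<^sup>2 \<le> onorm (cadjoint x \<circ> x)"
        using onorm_pos_le[OF b2] onorm_pos_le[OF bop_bl[OF x]] by (metis power_mono real_sqrt_pow2)
    qed
    fix y :: "'a \<Rightarrow> 'a" assume y: "y \<in> carrier BH"
    show "star BH (x \<oplus>\<^bsub>BH\<^esub> y) = star BH x \<oplus>\<^bsub>BH\<^esub> star BH y"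
      unfolding bop_simps
      by (rule adj_eq) (auto simp: bop_closed x y adj_ex cinner_add_left cinner_add_right)
    show "star BH (x \<otimes>\<^bsub>BH\<^esub> y) = star BH y \<otimes>\<^bsub>BH\<^esub> star BH x"
      unfolding bop_simps
      by (rule adj_eq) (auto simp: bop_closed x y adj_ex)
    show "alg_norm BH (x \<oplus>\<^bsub>BH\<^esub> y) \<le> alg_norm BH x + alg_norm BH y"
      unfolding bop_simps by (rule onorm_triangle) (use x y bop_bl in auto)
    show "alg_norm BH (x \<otimes>\<^bsub>BH\<^esub> y) \<le> alg_norm BH x * alg_norm BH y"
      unfolding bop_simps by (rule onorm_compose) (use x y bop_bl in auto)
  next
    fix s :: "nat \<Rightarrow> 'a \<Rightarrow> 'a" assume "range s \<subseteq> carrier BH" "norm_Cauchy BH s"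
    then show "\<exists>x\<in>carrier BH. norm_tendsto BH s x" by (rule bop_complete)
  qed (auto simp: bop_all)
qed


end

theory Submission
  imports Defs
begin

text \<open>On a space with a basis indexed by the natural numbers there are two sequences
  of self-adjoint unitaries \<open>s k\<close> and \<open>t k\<close> (Pauli matrices Z and X on the \<open>k\<close>-th binary digit), each
  commuting within itself, such that \<open>s k\<close> anticommutes with \<open>t k\<close> and commutes with the other
  \<open>t j\<close>. Their bicommutants C and D are commutative C*-subalgebras. A point of the spectrum of C
  becomes a projection p in M on which every \<open>\<phi> (s k)\<close> acts as a sign, and these projections have
  least upper bound 1; likewise for D, with projections q. As \<open>s k\<close> flips the two spectral
  projections of \<open>t k\<close>, each of the first n digits halves the squared norm of p q, which is
  therefore 0. Taking least upper bounds over q and then over p yields 1 = 0 in M.\<close>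

section \<open>Orthogonality from anticommuting symmetries\<close>

context cstar_algebra
begin

text \<open>Restates the module laws over the record \<open>complex_ring\<close> in ordinary complex
  arithmetic, which lets the simplifier handle factors such as 1/2 and -1.\<close>

lemma smult_complex:
  assumes "x \<in> carrier A"
  shows "(a + b) \<odot> x = a \<odot> x \<oplus> b \<odot> x" "(a * b) \<odot> x = a \<odot> (b \<odot> x)" "1 \<odot> x = x"
    "0 \<odot> x = \<zero>" "(-1) \<odot> x = \<ominus> x"
proof -
  show "(a + b) \<odot> x = a \<odot> x \<oplus> b \<odot> x" "(a * b) \<odot> x = a \<odot> (b \<odot> x)"
    using smult_l_distr[of a b x] smult_assoc1[of a b x] assms by simp_all
  show one: "1 \<odot> x = x" using smult_one[of x] assms by simp
  show zero: "0 \<odot> x = \<zero>" using smult_l_null[of x] assms by simp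
  have "(-1) \<odot> x \<oplus> x = (-1 + 1) \<odot> x"
    using smult_l_distr[of "-1" 1 x] assms one by simp
  then show "(-1) \<odot> x = \<ominus> x"
    using assms zero by (intro minus_equality[symmetric]) auto
qed

lemma star_uminus: "x \<in> carrier A \<Longrightarrow> star A (\<ominus> x) = \<ominus> star A x"
  using smult_complex(5)[of x] smult_complex(5)[of "star A x"] star_smult[of x "-1"] star_closed[of x]
  by simp

lemma eq_zero_if_eq_uminus:
  assumes "x \<in> carrier A" "x = \<ominus> x"
  shows "x = \<zero>"
proof -
  have "2 \<odot> x = \<zero>"
    using smult_complex(1)[of x 1 1] smult_complex(3)[of x] assms by (metis one_add_one r_neg)
  then show ?thesis
    using smult_complex(2)[of x "1/2" 2] smult_complex(3)[of x] assms(1) smult_r_null[of "1/2"] by simp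
qed

text \<open>The C*-identity and submultiplicativity bound the squared norm of \<open>x\<close> by
  the product of the norms of \<open>star A x\<close> and \<open>x\<close>. Cancelling gives one
  inequality, and applying it to \<open>star A x\<close> gives the other.\<close>

lemma norm_star: "x \<in> carrier A \<Longrightarrow> alg_norm A (star A x) = alg_norm A x"
proof (rule antisym)
  have le: "alg_norm A x \<le> alg_norm A (star A x)" if "x \<in> carrier A" for x
  proof -
    have "(alg_norm A x)\<^sup>2 \<le> alg_norm A (star A x) * alg_norm A x"
      using norm_mult[of "star A x" x] cstar_identity[of x] star_closed that by simp
    then show ?thesis
      using norm_nonneg[of x] norm_nonneg[of "star A x"] star_closed that
      by (cases "alg_norm A x = 0") (auto simp: power2_eq_square)
  qed
  assume x: "x \<in> carrier A"
  show "alg_norm A x \<le> alg_norm A (star A x)" by (rule le[OF x])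
  show "alg_norm A (star A x) \<le> alg_norm A x"
    using le[of "star A x"] star_star[OF x] star_closed[OF x] by simp
qed

lemma cstar_identity': "x \<in> carrier A \<Longrightarrow> alg_norm A (x \<otimes> star A x) = (alg_norm A x)\<^sup>2"
  using cstar_identity[of "star A x"] star_star[of x] star_closed[of x] norm_star[of x] by simp

text \<open>By the C*-identity the squared norm is that of half of \<open>v + u\<close>, where
  \<open>v = w w'\<close>, \<open>u = w T w'\<close> and \<open>w'\<close> is the adjoint of
  \<open>w\<close>. Since \<open>w\<close> absorbs \<open>S\<close> on the right and
  \<open>w'\<close> absorbs it on the left, moving \<open>S\<close> past \<open>T\<close> shows
  \<open>u = -u\<close>, so only \<open>v / 2\<close> remains.\<close>

lemma spin_halving:
  assumes w: "w \<in> carrier A" and S: "S \<in> carrier A" "star A S = S"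
    and T: "T \<in> carrier A" "star A T = T" "T \<otimes> T = \<one>"
    and anti: "S \<otimes> T = \<ominus> (T \<otimes> S)" and wS: "w \<otimes> S = w"
  shows "(alg_norm A ((1/2) \<odot> (w \<oplus> w \<otimes> T)))\<^sup>2 = (alg_norm A w)\<^sup>2 / 2"
proof -
  define w' where "w' = star A w"
  note cl = w S T star_closed[OF w, folded w'_def]
  define v where "v = w \<otimes> w'"
  define u where "u = w \<otimes> T \<otimes> w'"
  have vc: "v \<in> carrier A" and uc: "u \<in> carrier A" using cl by (auto simp: v_def u_def)
  have Sw: "S \<otimes> w' = w'"
    using star_mult[OF w S(1)] S(2) wS by (simp add: w'_def)
  have "u = w \<otimes> S \<otimes> T \<otimes> w'" by (simp add: u_def wS)
  also have "\<dots> = w \<otimes> (S \<otimes> T) \<otimes> w'" using cl by (simp add: m_assoc)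
  also have "\<dots> = \<ominus> (w \<otimes> (T \<otimes> (S \<otimes> w')))"
    using cl by (simp add: anti l_minus r_minus m_assoc)
  also have "\<dots> = \<ominus> u" using cl by (simp add: Sw u_def m_assoc)
  finally have u0: "u = \<zero>" using uc eq_zero_if_eq_uminus by blast
  have "star A ((1/2) \<odot> (w \<oplus> w \<otimes> T)) = (1/2) \<odot> (w' \<oplus> T \<otimes> w')"
    using cl star_smult[of "w \<oplus> w \<otimes> T" "1/2"] star_add[of w "w \<otimes> T"] star_mult[of w T]
    by (simp add: w'_def)
  then have "((1/2) \<odot> (w \<oplus> w \<otimes> T)) \<otimes> star A ((1/2) \<odot> (w \<oplus> w \<otimes> T))
      = (1/2) \<odot> ((1/2) \<odot> ((w \<oplus> w \<otimes> T) \<otimes> (w' \<oplus> T \<otimes> w')))"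
    using cl smult_mult_left smult_mult_right by simp
  also have "(w \<oplus> w \<otimes> T) \<otimes> (w' \<oplus> T \<otimes> w') = (v \<oplus> u) \<oplus> (u \<oplus> v)"
  proof -
    have "T \<otimes> (T \<otimes> w') = w'" using cl m_assoc[of T T w'] by simp
    then show ?thesis using cl by (simp add: l_distr r_distr m_assoc v_def u_def a_assoc)
  qed
  also have "\<dots> = 2 \<odot> v"
    using vc smult_complex(1)[of v 1 1] smult_complex(3)[of v] by (simp add: u0)
  also have "(1/2) \<odot> (2 \<odot> v) = v"
    using smult_complex(2)[of v "1/2" 2] smult_complex(3)[of v] vc by simp
  finally have eq: "((1/2) \<odot> (w \<oplus> w \<otimes> T)) \<otimes> star A ((1/2) \<odot> (w \<oplus> w \<otimes> T)) = (1/2) \<odot> v" .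
  have "(alg_norm A ((1/2) \<odot> (w \<oplus> w \<otimes> T)))\<^sup>2 = alg_norm A ((1/2) \<odot> v)"
    using cstar_identity'[of "(1/2) \<odot> (w \<oplus> w \<otimes> T)"] cl eq by simp
  also have "\<dots> = alg_norm A v / 2" using norm_smult[OF vc, of "1/2"] by simp
  also have "alg_norm A v = (alg_norm A w)\<^sup>2" using cstar_identity'[OF w] by (simp add: v_def w'_def)
  finally show ?thesis .
qed

text \<open>Multiplying \<open>p\<close> on the right by \<open>(1 + T k) / 2\<close> for the first
  \<open>n\<close> indices leaves \<open>p \<otimes> q\<close> unchanged, because \<open>T k\<close>
  fixes \<open>q\<close>. Each factor halves the squared norm by \<open>spin_halving\<close>, so the
  norm of \<open>p \<otimes> q\<close> is below every positive bound.\<close>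

lemma orthogonal_of_spins:
  fixes S T :: "nat \<Rightarrow> 'a"
  assumes p: "p \<in> carrier A" and q: "q \<in> carrier A"
    and S: "\<And>n. S n \<in> carrier A" "\<And>n. star A (S n) = S n"
    and T: "\<And>n. T n \<in> carrier A" "\<And>n. star A (T n) = T n" "\<And>n. T n \<otimes> T n = \<one>"
    and anti: "\<And>n. S n \<otimes> T n = \<ominus> (T n \<otimes> S n)"
    and comm: "\<And>m n. m \<noteq> n \<Longrightarrow> S m \<otimes> T n = T n \<otimes> S m"
    and pS: "\<And>n. p \<otimes> S n = p" and Tq: "\<And>n. T n \<otimes> q = q"
  shows "p \<otimes> q = \<zero>"
proof -
  define w where "w = rec_nat p (\<lambda>n w. (1/2) \<odot> (w \<oplus> w \<otimes> T n))"
  have w0: "w 0 = p" and wS: "w (Suc n) = (1/2) \<odot> (w n \<oplus> w n \<otimes> T n)" for n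
    by (simp_all add: w_def)
  have half: "(1/2) \<odot> (x \<oplus> x) = x" if "x \<in> carrier A" for x
    using that smult_complex(1)[of x "1/2" "1/2"] smult_complex(3)[of x] smult_r_distr[of "1/2" x x]
    by simp
  \<comment> \<open>The middle clause is what allows the next halving: \<open>S m\<close> with
    \<open>m \<ge> n\<close> commutes with all factors \<open>T k\<close>, \<open>k < n\<close>,
    used so far and therefore still fixes \<open>w n\<close>.\<close>
  have inv: "w n \<in> carrier A \<and> (\<forall>m\<ge>n. w n \<otimes> S m = w n) \<and> w n \<otimes> q = p \<otimes> q" for n
  proof (induction n)
    case 0
    then show ?case using p pS by (simp add: w0)
  next
    case (Suc n)
    then have wn: "w n \<in> carrier A" by simp
    have "w (Suc n) \<otimes> S m = w (Suc n)" if m: "m \<ge> Suc n" for m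
    proof -
      have wm: "w n \<otimes> S m = w n" using Suc m by simp
      have "w n \<otimes> T n \<otimes> S m = w n \<otimes> S m \<otimes> T n"
        using wn S(1)[of m] T(1)[of n] comm[of m n] m by (simp add: m_assoc)
      then show ?thesis
        using wn S(1)[of m] T(1)[of n] by (simp add: wS smult_mult_left l_distr wm)
    qed
    moreover have "w (Suc n) \<otimes> q = p \<otimes> q"
    proof -
      have "w n \<otimes> T n \<otimes> q = w n \<otimes> q" using wn T(1)[of n] q Tq[of n] by (simp add: m_assoc)
      then show ?thesis
        using Suc wn T(1)[of n] p q half[of "p \<otimes> q"] by (simp add: wS smult_mult_left l_distr)
    qed
    ultimately show ?case using wn T(1)[of n] by (simp add: wS)
  qed
  have nw: "(alg_norm A (w n))\<^sup>2 = (alg_norm A p)\<^sup>2 * (1/2) ^ n" for n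
  proof (induction n)
    case (Suc n)
    show ?case
      using spin_halving[of "w n" "S n" "T n"] inv[of n] S T anti Suc by (simp add: wS)
  qed (simp add: w0)
  have "(alg_norm A (p \<otimes> q))\<^sup>2 \<le> (alg_norm A p)\<^sup>2 * (1/2) ^ n * (alg_norm A q)\<^sup>2" for n
  proof -
    have "alg_norm A (p \<otimes> q) \<le> alg_norm A (w n) * alg_norm A q"
      using norm_mult[of "w n" q] inv[of n] q by simp
    then have "(alg_norm A (p \<otimes> q))\<^sup>2 \<le> (alg_norm A (w n) * alg_norm A q)\<^sup>2"
      using norm_nonneg[of "p \<otimes> q"] p q by (intro power_mono) auto
    then show ?thesis by (simp add: power_mult_distrib nw)
  qed
  moreover have "(\<lambda>n. (alg_norm A p)\<^sup>2 * (1/2) ^ n * (alg_norm A q)\<^sup>2) \<longlonglongrightarrow> (alg_norm A p)\<^sup>2 * 0 * (alg_norm A q)\<^sup>2"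
    by (intro tendsto_intros) simp
  ultimately have "(alg_norm A (p \<otimes> q))\<^sup>2 \<le> (alg_norm A p)\<^sup>2 * 0 * (alg_norm A q)\<^sup>2"
    by (intro LIMSEQ_le_const) blast+
  then show ?thesis using norm_eq_zero_iff[of "p \<otimes> q"] p q by simp
qed

end

section \<open>Bicommutants\<close>

text \<open>Bicommutants replace generated C*-algebras here: closure under limits then follows from
  continuity of multiplication, with no explicit closure construction.\<close>

definition commutant :: "('a, 'm) star_algebra_scheme \<Rightarrow> 'a set \<Rightarrow> 'a set" where
  "commutant A S = {x \<in> carrier A. \<forall>s\<in>S. x \<otimes>\<^bsub>A\<^esub> s = s \<otimes>\<^bsub>A\<^esub> x}"

lemma subset_bicommutant: "S \<subseteq> carrier A \<Longrightarrow> S \<subseteq> commutant A (commutant A S)"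
  by (auto simp: commutant_def)

context cstar_algebra
begin

text \<open>The commutator with \<open>t\<close> has norm at most twice that of \<open>t\<close>
  times that of its argument, and it vanishes on each \<open>s n\<close>; hence it vanishes at the
  limit.\<close>

lemma norm_tendsto_commutant:
  assumes S: "S \<subseteq> carrier A" and s: "range s \<subseteq> commutant A S"
    and x: "x \<in> carrier A" "norm_tendsto A s x"
  shows "x \<in> commutant A S"
proof -
  have "x \<otimes> t = t \<otimes> x" if t: "t \<in> S" for t
  proof -
    have tc: "t \<in> carrier A" using t S by blast
    define d where "d = t \<otimes> x \<ominus> x \<otimes> t"
    have le: "alg_norm A d \<le> 2 * alg_norm A t * alg_norm A (s n \<ominus> x)" for n
    proof -
      have sn: "s n \<in> carrier A" and st: "s n \<otimes> t = t \<otimes> s n"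
        using s t by (auto simp: commutant_def)
      define y where "y = s n \<ominus> x"
      have yc: "y \<in> carrier A" using sn x by (simp add: y_def)
      \<comment> \<open>The terms involving \<open>s n\<close> cancel because \<open>s n\<close>
        commutes with \<open>t\<close>. The minus sign is the scalar -1, so that
        \<open>norm_smult\<close> applies.\<close>
      have "d = y \<otimes> t \<oplus> (-1) \<odot> (t \<otimes> y)"
        using tc sn x st smult_complex(5)[of "t \<otimes> y"] yc
        by (simp add: y_def d_def a_minus_def l_distr r_distr l_minus r_minus minus_add)
          (simp add: a_ac r_neg1 r_neg2 r_neg a_lcomm[of "t \<otimes> s n" "\<ominus> (x \<otimes> t)"])
      then have "alg_norm A d \<le> alg_norm A (y \<otimes> t) + alg_norm A (t \<otimes> y)"
        using norm_triangle[of "y \<otimes> t" "(-1) \<odot> (t \<otimes> y)"] norm_smult[of "t \<otimes> y" "-1"] tc yc by simp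
      also have "\<dots> \<le> 2 * alg_norm A t * alg_norm A y"
        using norm_mult[OF yc tc] norm_mult[OF tc yc] by (simp add: algebra_simps)
      finally show ?thesis by (simp add: y_def)
    qed
    have "(\<lambda>n. 2 * alg_norm A t * alg_norm A (s n \<ominus> x)) \<longlonglongrightarrow> 2 * alg_norm A t * 0"
      using x(2) unfolding norm_tendsto_def by (intro tendsto_intros)
    then have "alg_norm A d \<le> 2 * alg_norm A t * 0"
      by (rule LIMSEQ_le_const) (use le in blast)
    then have "d = \<zero>"
      using norm_eq_zero_iff[of d] norm_nonneg[of d] tc x by (simp add: d_def)
    then show ?thesis using tc x by (simp add: d_def)
  qed
  then show ?thesis using x by (simp add: commutant_def)
qed

lemma star_commutant:
  assumes S: "S \<subseteq> carrier A" "star A ` S \<subseteq> S" and x: "x \<in> commutant A S"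
  shows "star A x \<in> commutant A S"
proof -
  have "star A x \<otimes> t = t \<otimes> star A x" if "t \<in> S" for t
  proof -
    have "x \<otimes> star A t = star A t \<otimes> x" using x S that by (auto simp: commutant_def)
    then have "star A (x \<otimes> star A t) = star A (star A t \<otimes> x)" by simp
    then show ?thesis
      using S(1) that x star_mult[of x "star A t"] star_mult[of "star A t" x] star_star[of t] star_closed[of t]
      by (auto simp: commutant_def)
  qed
  then show ?thesis using x star_closed by (simp add: commutant_def)
qed

text \<open>Commutativity of \<open>S\<close> puts it inside its commutant \<open>S'\<close>. Taking
  commutants reverses inclusions, so the bicommutant also lies in \<open>S'\<close>; its elements
  commute with all of \<open>S'\<close>, hence with each other.\<close>

lemma commutative_cstar_subalgebra_bicommutant:
  assumes S: "S \<subseteq> carrier A" "star A ` S \<subseteq> S"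
    and comm: "\<And>s t. s \<in> S \<Longrightarrow> t \<in> S \<Longrightarrow> s \<otimes> t = t \<otimes> s"
  shows "commutative_cstar_subalgebra (commutant A (commutant A S)) A"
proof -
  define S' where "S' = commutant A S"
  have S': "S' \<subseteq> carrier A" "star A ` S' \<subseteq> S'" "S \<subseteq> S'"
    using star_commutant[OF S] S(1) comm by (auto simp: S'_def commutant_def)
  then have sub: "commutant A S' \<subseteq> S'" by (auto simp: commutant_def S'_def)
  have "subring (commutant A S') A"
    using S'(1)
    by (intro subringI)
      (auto simp: commutant_def l_minus r_minus l_distr r_distr m_assoc subset_iff, metis m_assoc)
  moreover have "h \<otimes> k = k \<otimes> h" if "h \<in> commutant A S'" "k \<in> commutant A S'" for h k
    using that sub by (auto simp: commutant_def)
  ultimately have "subcring (commutant A S') A" by (rule subcringI)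
  moreover have "c \<odot> x \<in> commutant A S'" if "x \<in> commutant A S'" for c x
    using that S'(1) smult_mult_left smult_mult_right by (auto simp: commutant_def subset_iff)
  ultimately show ?thesis
    using star_commutant[OF S'(1,2)] norm_tendsto_commutant[OF S'(1)]
    unfolding commutative_cstar_subalgebra_def S'_def by blast
qed

end

section \<open>Projections from points of the spectrum\<close>

text \<open>The right annihilator of \<open>z\<close> is generated by a projection \<open>p\<close>
  that dominates every member of \<open>Q\<close>. As \<open>Q\<close> has least upper bound 1,
  \<open>p\<close> is 1, so \<open>z\<close> annihilates the unit.\<close>

lemma (in awstar_algebra) eq_zero_if_annihilates_lub_one:
  assumes z: "z \<in> carrier A" and Q: "Q \<subseteq> projections A"
    and lub: "is_lub (projection_order A) \<one> Q"
    and ann: "\<And>q. q \<in> Q \<Longrightarrow> z \<otimes> q = \<zero>"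
  shows "z = \<zero>"
proof -
  obtain p where p: "p \<in> projections A" and R: "right_annihilator A {z} = (\<lambda>x. p \<otimes> x) ` carrier A"
    using right_annihilator_projection[of "{z}"] z by auto
  have pc: "p \<in> carrier A" "p \<otimes> p = p" "star A p = p" using p by (auto simp: projections_def)
  have "q \<otimes> p = q" if q: "q \<in> Q" for q
  proof -
    have qc: "q \<in> carrier A" "star A q = q" using q Q by (auto simp: projections_def)
    then have "q \<in> right_annihilator A {z}" using ann[OF q] by (simp add: right_annihilator_def)
    then obtain x where x: "x \<in> carrier A" "q = p \<otimes> x" using R by blast
    then have "p \<otimes> q = q" using pc m_assoc[of p p x] by simp
    \<comment> \<open>Taking adjoints turns \<open>p \<otimes> q = q\<close> into
      \<open>q \<otimes> p = q\<close>, the form used in \<open>projection_order\<close>.\<close>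
    then show ?thesis using star_mult[of p q] pc qc by simp
  qed
  then have "p \<in> Upper (projection_order A) Q" using p by (auto simp: Upper_def projection_order_def)
  then have "\<one> \<otimes> p = \<one>" using lub unfolding least_def by (auto simp: projection_order_def)
  then have "p = \<one>" using pc by simp
  then have "\<one> \<in> right_annihilator A {z}" using R by force
  then show ?thesis using z by (simp add: right_annihilator_def)
qed

lemma star_hom_projection:
  "star_hom A B \<psi> \<Longrightarrow> p \<in> projections A \<Longrightarrow> \<psi> p \<in> projections B"
  unfolding star_hom_def projections_def by (auto simp: ring_hom_closed simp flip: ring_hom_mult)

text \<open>A projection above every point indicator has value 1 at each point, so the unit is the
  only upper bound. Point indicators are in general not continuous, and this is what passing from
  C(X) to all bounded functions gains.\<close>

lemma l_infinity_lub_atoms: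
  fixes X :: "'x set"
  defines "\<delta> \<equiv> \<lambda>x. \<lambda>y\<in>X. if y = x then 1 else 0"
  shows "\<delta> ` X \<subseteq> projections (l_infinity X)"
    and "is_lub (projection_order (l_infinity X)) \<one>\<^bsub>l_infinity X\<^esub> (\<delta> ` X)"
proof -
  let ?L = "l_infinity X"
  have c: "\<delta> x \<in> carrier ?L" for x by (rule linf_carrierI[where B=1]) (auto simp: \<delta>_def)
  then show sub: "\<delta> ` X \<subseteq> projections ?L"
    by (auto simp: projections_def linf_simps fun_eq_iff) (auto simp: \<delta>_def)
  have one: "\<one>\<^bsub>?L\<^esub> \<in> projections ?L"
    by (auto simp: projections_def linf_simps linf_const)
  have "u = \<one>\<^bsub>?L\<^esub>" if u: "u \<in> projections ?L" "\<And>x. x \<in> X \<Longrightarrow> \<delta> x \<otimes>\<^bsub>?L\<^esub> u = \<delta> x" for u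
  proof (rule linf_eqI[of _ X])
    show "u \<in> extensional X" using u(1) linf_ext by (auto simp: projections_def)
    show "u x = \<one>\<^bsub>?L\<^esub> x" if "x \<in> X" for x
      using fun_cong[OF u(2)[OF that], of x] that by (simp add: linf_simps \<delta>_def)
  qed (simp add: linf_simps)
  moreover have "\<delta> x \<otimes>\<^bsub>?L\<^esub> \<one>\<^bsub>?L\<^esub> = \<delta> x" if "x \<in> X" for x
    by (auto simp: linf_simps \<delta>_def)
  moreover have "\<one>\<^bsub>?L\<^esub> \<otimes>\<^bsub>?L\<^esub> \<one>\<^bsub>?L\<^esub> = \<one>\<^bsub>?L\<^esub>" using one by (simp add: projections_def)
  ultimately have U: "Upper (projection_order ?L) (\<delta> ` X) = {\<one>\<^bsub>?L\<^esub>}"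
    and le: "le (projection_order ?L) \<one>\<^bsub>?L\<^esub> \<one>\<^bsub>?L\<^esub>"
    using one sub unfolding Upper_def projection_order_def gorder.simps partial_object.simps by blast+
  have "{\<one>\<^bsub>?L\<^esub>} \<subseteq> carrier (projection_order ?L)" using one by (simp add: projection_order_def)
  then show "is_lub (projection_order ?L) \<one>\<^bsub>?L\<^esub> (\<delta> ` X)"
    unfolding least_def U using le by blast
qed

text \<open>Only elements with square one are considered: their Gelfand transforms are visibly bounded,
  so no spectral theory is required.\<close>

lemma discretization_eigenprojections:
  assumes disc: "discretization A M \<phi>" and C: "commutative_cstar_subalgebra C A"
  obtains Q where "Q \<subseteq> projections M" "is_lub (projection_order M) \<one>\<^bsub>M\<^esub> Q"
    "\<And>q c. q \<in> Q \<Longrightarrow> c \<in> C \<Longrightarrow> c \<otimes>\<^bsub>A\<^esub> c = \<one>\<^bsub>A\<^esub> \<Longrightarrow>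
      \<phi> c \<otimes>\<^bsub>M\<^esub> q = q \<or> \<phi> c \<otimes>\<^bsub>M\<^esub> q = \<ominus>\<^bsub>M\<^esub> q"
proof -
  define X where "X = topspace (gelfand_spectrum A C)"
  define L where "L = l_infinity X"
  define \<delta> :: "('a \<Rightarrow> complex) \<Rightarrow> ('a \<Rightarrow> complex) \<Rightarrow> complex" where "\<delta> = (\<lambda>x. \<lambda>y\<in>X. if y = x then 1 else 0)"
  interpret M: awstar_algebra M using disc by (simp add: discretization_def)
  obtain \<psi> where mor: "awstar_morphism L M \<psi>"
    and fac: "\<And>c. c \<in> C \<Longrightarrow> \<psi> (gelfand_transform A C c) = \<phi> c"
    using disc C unfolding discretization_def L_def X_def by blast
  have sh: "star_hom L M \<psi>" using mor by (simp add: awstar_morphism_def)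
  then have rh: "\<psi> \<in> ring_hom L M" by (simp add: star_hom_def)
  have atoms: "\<delta> ` X \<subseteq> projections L" "is_lub (projection_order L) \<one>\<^bsub>L\<^esub> (\<delta> ` X)"
    using l_infinity_lub_atoms[of X] by (simp_all add: L_def \<delta>_def)
  show ?thesis
  proof
    show "\<psi> ` \<delta> ` X \<subseteq> projections M"
      using atoms(1) star_hom_projection[OF sh] by blast
    show "is_lub (projection_order M) \<one>\<^bsub>M\<^esub> (\<psi> ` \<delta> ` X)"
      using mor atoms ring_hom_one[OF rh] unfolding awstar_morphism_def by metis
    fix q c assume "q \<in> \<psi> ` \<delta> ` X" and c: "c \<in> C" "c \<otimes>\<^bsub>A\<^esub> c = \<one>\<^bsub>A\<^esub>"
    then obtain x where x: "x \<in> X" "q = \<psi> (\<delta> x)" by blast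
    define g where "g = gelfand_transform A C c"
    have g: "g = (\<lambda>\<gamma>\<in>X. \<gamma> c)" by (simp add: g_def gelfand_transform_def X_def)
    \<comment> \<open>A character is multiplicative and unital, so its value at a square root of 1
      squares to 1.\<close>
    have pm: "\<gamma> c = 1 \<or> \<gamma> c = -1" if "\<gamma> \<in> X" for \<gamma>
    proof -
      have "\<gamma> \<in> ring_hom (A\<lparr>carrier := C\<rparr>) complex_ring"
        using that by (auto simp: X_def gelfand_spectrum_def characters_def)
      then have "\<gamma> c * \<gamma> c = 1"
        using ring_hom_mult[of \<gamma> "A\<lparr>carrier := C\<rparr>" complex_ring c c]
          ring_hom_one[of \<gamma> "A\<lparr>carrier := C\<rparr>" complex_ring] c by simp
      then show ?thesis by (simp add: square_eq_1_iff)
    qed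
    have gL: "g \<in> carrier L"
      unfolding L_def by (rule linf_carrierI[where B=1]) (use pm in \<open>force simp: g\<close>)+
    have dL: "\<delta> x \<in> carrier L" using atoms(1) x by (auto simp: projections_def)
    \<comment> \<open>Multiplication by the indicator of the point \<open>x\<close> leaves only the
      value of \<open>g\<close> there, which is the character \<open>x\<close> evaluated at
      \<open>c\<close>.\<close>
    have "g \<otimes>\<^bsub>L\<^esub> \<delta> x = x c \<odot>\<^bsub>L\<^esub> \<delta> x"
      by (auto simp: L_def linf_simps g \<delta>_def)
    then have "\<phi> c \<otimes>\<^bsub>M\<^esub> q = \<psi> (x c \<odot>\<^bsub>L\<^esub> \<delta> x)"
      using ring_hom_mult[OF rh gL dL] fac[OF c(1)] x(2) by (simp add: g_def)
    also have "\<dots> = x c \<odot>\<^bsub>M\<^esub> q"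
      using sh dL x(2) by (simp add: star_hom_def)
    finally show "\<phi> c \<otimes>\<^bsub>M\<^esub> q = q \<or> \<phi> c \<otimes>\<^bsub>M\<^esub> q = \<ominus>\<^bsub>M\<^esub> q"
      using pm[OF x(1)] M.smult_complex(3,5)[of q] ring_hom_closed[OF rh dL] x(2) by auto
  qed
qed

section \<open>Vanishing of the target algebra\<close>

text \<open>Reduces the theorem to finding two spin sequences in \<open>A\<close>. Each sequence
  lies in a commutative subalgebra of its own, so the definition of a discretization is applied
  twice; the relations between the sequences then make the two resulting families of projections
  mutually orthogonal.\<close>

lemma discretization_zero_of_spins:
  fixes s t :: "nat \<Rightarrow> 'a"
  assumes disc: "discretization A M \<phi>"
    and s: "\<And>n. s n \<in> carrier A" "\<And>n. star A (s n) = s n" "\<And>n. s n \<otimes>\<^bsub>A\<^esub> s n = \<one>\<^bsub>A\<^esub>"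
    and t: "\<And>n. t n \<in> carrier A" "\<And>n. star A (t n) = t n" "\<And>n. t n \<otimes>\<^bsub>A\<^esub> t n = \<one>\<^bsub>A\<^esub>"
    and ss: "\<And>m n. s m \<otimes>\<^bsub>A\<^esub> s n = s n \<otimes>\<^bsub>A\<^esub> s m"
    and tt: "\<And>m n. t m \<otimes>\<^bsub>A\<^esub> t n = t n \<otimes>\<^bsub>A\<^esub> t m"
    and st: "\<And>m n. m \<noteq> n \<Longrightarrow> s m \<otimes>\<^bsub>A\<^esub> t n = t n \<otimes>\<^bsub>A\<^esub> s m"
    and anti: "\<And>n. s n \<otimes>\<^bsub>A\<^esub> t n = (-1) \<odot>\<^bsub>A\<^esub> (t n \<otimes>\<^bsub>A\<^esub> s n)"
  shows "carrier M = {\<zero>\<^bsub>M\<^esub>}"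
proof -
  interpret A: cstar_algebra A using disc by (simp add: discretization_def)
  interpret M: awstar_algebra M using disc by (simp add: discretization_def)
  have sh: "star_hom A M \<phi>" using disc by (simp add: discretization_def)
  then have rh: "\<phi> \<in> ring_hom A M" by (simp add: star_hom_def)
  define C where "C r = commutant A (commutant A (range r))" for r :: "nat \<Rightarrow> 'a"
  have C: "commutative_cstar_subalgebra (C s) A" "commutative_cstar_subalgebra (C t) A"
    unfolding C_def using s t ss tt
    by (intro A.commutative_cstar_subalgebra_bicommutant; force)+
  have mem: "s n \<in> C s" "t n \<in> C t" for n
    using subset_bicommutant[of "range s" A] subset_bicommutant[of "range t" A] s(1) t(1)
    by (auto simp: C_def)
  obtain P where P: "P \<subseteq> projections M" "is_lub (projection_order M) \<one>\<^bsub>M\<^esub> P"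
    "\<And>p n. p \<in> P \<Longrightarrow> \<phi> (s n) \<otimes>\<^bsub>M\<^esub> p = p \<or> \<phi> (s n) \<otimes>\<^bsub>M\<^esub> p = \<ominus>\<^bsub>M\<^esub> p"
    using discretization_eigenprojections[OF disc C(1)] mem(1) s(3) by metis
  obtain Q where Q: "Q \<subseteq> projections M" "is_lub (projection_order M) \<one>\<^bsub>M\<^esub> Q"
    "\<And>q n. q \<in> Q \<Longrightarrow> \<phi> (t n) \<otimes>\<^bsub>M\<^esub> q = q \<or> \<phi> (t n) \<otimes>\<^bsub>M\<^esub> q = \<ominus>\<^bsub>M\<^esub> q"
    using discretization_eigenprojections[OF disc C(2)] mem(2) t(3) by metis
  \<comment> \<open>The sign by which \<open>\<phi> (s n)\<close> acts on \<open>p\<close> is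
    absorbed into \<open>S p n\<close>, and likewise for \<open>T\<close>. Changing signs preserves
    self-adjointness, squares and all (anti)commutation relations.\<close>
  define S where "S p n = (if \<phi> (s n) \<otimes>\<^bsub>M\<^esub> p = p then \<phi> (s n) else \<ominus>\<^bsub>M\<^esub> \<phi> (s n))" for p n
  define T where "T q n = (if \<phi> (t n) \<otimes>\<^bsub>M\<^esub> q = q then \<phi> (t n) else \<ominus>\<^bsub>M\<^esub> \<phi> (t n))" for q n
  have \<phi>: "\<phi> (s n) \<in> carrier M" "star M (\<phi> (s n)) = \<phi> (s n)"
    "\<phi> (t n) \<in> carrier M" "star M (\<phi> (t n)) = \<phi> (t n)" "\<phi> (t n) \<otimes>\<^bsub>M\<^esub> \<phi> (t n) = \<one>\<^bsub>M\<^esub>" for n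
    using sh s t ring_hom_closed[OF rh] ring_hom_mult[OF rh t(1) t(1), symmetric] ring_hom_one[OF rh]
    unfolding star_hom_def by metis+
  have \<phi>st: "\<phi> (s m) \<otimes>\<^bsub>M\<^esub> \<phi> (t n) = \<phi> (t n) \<otimes>\<^bsub>M\<^esub> \<phi> (s m)" if "m \<noteq> n" for m n
    using st[OF that] ring_hom_mult[OF rh s(1) t(1)] ring_hom_mult[OF rh t(1) s(1)] by metis
  have \<phi>anti: "\<phi> (s n) \<otimes>\<^bsub>M\<^esub> \<phi> (t n) = \<ominus>\<^bsub>M\<^esub> (\<phi> (t n) \<otimes>\<^bsub>M\<^esub> \<phi> (s n))" for n
  proof -
    have "\<phi> (s n) \<otimes>\<^bsub>M\<^esub> \<phi> (t n) = \<phi> ((-1) \<odot>\<^bsub>A\<^esub> (t n \<otimes>\<^bsub>A\<^esub> s n))"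
      using ring_hom_mult[OF rh s(1) t(1)] anti by metis
    also have "\<dots> = (-1) \<odot>\<^bsub>M\<^esub> (\<phi> (t n) \<otimes>\<^bsub>M\<^esub> \<phi> (s n))"
      using sh ring_hom_mult[OF rh t(1) s(1)] A.m_closed[OF t(1) s(1)] unfolding star_hom_def by metis
    finally show ?thesis using M.smult_complex(5) \<phi> by simp
  qed
  have orth: "p \<otimes>\<^bsub>M\<^esub> q = \<zero>\<^bsub>M\<^esub>" if p: "p \<in> P" and q: "q \<in> Q" for p q
  proof (rule M.orthogonal_of_spins[where S="S p" and T="T q"])
    show pc: "p \<in> carrier M" and qc: "q \<in> carrier M" using p q P(1) Q(1) by (auto simp: projections_def)
    show Sc: "S p n \<in> carrier M" and Ss: "star M (S p n) = S p n" for n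
      using \<phi>[of n] M.star_uminus by (auto simp: S_def)
    show "T q n \<in> carrier M" "star M (T q n) = T q n" "T q n \<otimes>\<^bsub>M\<^esub> T q n = \<one>\<^bsub>M\<^esub>" for n
      using \<phi>[of n] M.star_uminus by (auto simp: T_def M.l_minus M.r_minus)
    show "S p n \<otimes>\<^bsub>M\<^esub> T q n = \<ominus>\<^bsub>M\<^esub> (T q n \<otimes>\<^bsub>M\<^esub> S p n)" for n
      using \<phi>[of n] \<phi>anti[of n] by (auto simp: S_def T_def M.l_minus M.r_minus)
    show "S p m \<otimes>\<^bsub>M\<^esub> T q n = T q n \<otimes>\<^bsub>M\<^esub> S p m" if "m \<noteq> n" for m n
      using \<phi>[of n] \<phi>[of m] \<phi>st[OF that] by (auto simp: S_def T_def M.l_minus M.r_minus)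
    show "T q n \<otimes>\<^bsub>M\<^esub> q = q" for n
      using Q(3)[OF q, of n] \<phi>[of n] qc by (auto simp: T_def M.l_minus)
    \<comment> \<open>The eigenvalue equation has \<open>p\<close> on the right, while
      \<open>orthogonal_of_spins\<close> needs it on the left; adjoints exchange the two.\<close>
    have "S p n \<otimes>\<^bsub>M\<^esub> p = p" for n
      using P(3)[OF p, of n] \<phi>[of n] pc by (auto simp: S_def M.l_minus)
    moreover have "star M p = p" using p P(1) by (auto simp: projections_def)
    ultimately show "p \<otimes>\<^bsub>M\<^esub> S p n = p" for n
      using M.star_mult[OF Sc[of n] pc] Ss[of n] by simp
  qed
  have "p = \<zero>\<^bsub>M\<^esub>" if "p \<in> P" for p
    using M.eq_zero_if_annihilates_lub_one[OF _ Q(1,2) orth[OF that]] P(1) that by (auto simp: projections_def)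
  then have "\<one>\<^bsub>M\<^esub> = \<zero>\<^bsub>M\<^esub>"
    \<comment> \<open>Here the annihilating element is 1 itself, since all members of
      \<open>P\<close> are 0.\<close>
    using M.eq_zero_if_annihilates_lub_one[OF M.one_closed P(1,2)] M.r_null[OF M.one_closed] by metis
  then show ?thesis by (rule M.one_zeroD)
qed


section \<open>Orthonormal bases and spin systems\<close>

text \<open>Families over an index set cover both sets of vectors, through the identity family, and
  sequences.\<close>

definition orthonormal :: "'i set \<Rightarrow> ('i \<Rightarrow> 'h::complex_hilbert) \<Rightarrow> bool" where
  "orthonormal I e \<longleftrightarrow> (\<forall>i\<in>I. \<forall>j\<in>I. cinner (e i) (e j) = (if i = j then 1 else 0))"

section \<open>Finite orthonormal expansions and Bessel's inequality\<close>

lemma orthonormalD: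
  "orthonormal I e \<Longrightarrow> i \<in> I \<Longrightarrow> j \<in> I \<Longrightarrow> cinner (e i) (e j) = (if i = j then 1 else 0)"
  by (simp add: orthonormal_def)

lemma cinner_sum_right: "cinner x (\<Sum>i\<in>F. f i) = (\<Sum>i\<in>F. cinner x (f i :: 'h::complex_hilbert))"
  by (induction F rule: infinite_finite_induct) (simp_all add: cinner_add_right)

lemma cinner_sum_left: "cinner (\<Sum>i\<in>F. f i) x = (\<Sum>i\<in>F. cinner (f i :: 'h::complex_hilbert) x)"
  by (induction F rule: infinite_finite_induct) (simp_all add: cinner_add_left)

lemma norm_sq_orthonormal_sum:
  assumes e: "orthonormal I e" and F: "finite F" "F \<subseteq> I"
  shows "(norm (\<Sum>i\<in>F. c i *\<^sub>C e i))\<^sup>2 = (\<Sum>i\<in>F. (cmod (c i))\<^sup>2)"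
proof -
  have "cinner (c i *\<^sub>C e i) (\<Sum>j\<in>F. c j *\<^sub>C e j) = complex_of_real ((cmod (c i))\<^sup>2)" if i: "i \<in> F" for i
  proof -
    have "cinner (c i *\<^sub>C e i) (\<Sum>j\<in>F. c j *\<^sub>C e j) = (\<Sum>j\<in>F. if j = i then cnj (c i) * c j else 0)"
      unfolding cinner_sum_right
      by (rule sum.cong) (use F i orthonormalD[OF e] in
          \<open>auto simp: cinner_scaleC_left cinner_scaleC_right subset_iff\<close>)
    then show ?thesis using F i complex_norm_square[of "c i"] by (simp add: mult.commute)
  qed
  then have "complex_of_real ((norm (\<Sum>i\<in>F. c i *\<^sub>C e i))\<^sup>2) = complex_of_real (\<Sum>i\<in>F. (cmod (c i))\<^sup>2)"
    unfolding cinner_self[symmetric] by (subst cinner_sum_left) simp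
  then show ?thesis by (simp only: of_real_eq_iff)
qed

lemma cinner_orthonormal_residual:
  assumes e: "orthonormal I e" and F: "finite F" "F \<subseteq> I" and j: "j \<in> F"
  shows "cinner (e j) (x - (\<Sum>i\<in>F. cinner (e i) x *\<^sub>C e i)) = 0"
proof -
  have "(\<Sum>i\<in>F. cinner (e j) (cinner (e i) x *\<^sub>C e i)) = (\<Sum>i\<in>F. if i = j then cinner (e i) x else 0)"
    by (rule sum.cong) (use F j orthonormalD[OF e] in \<open>auto simp: cinner_scaleC_right subset_iff\<close>)
  then show ?thesis using F j by (simp add: cinner_diff_right cinner_sum_right)
qed

lemma bessel_inequality:
  assumes e: "orthonormal I e" and F: "finite F" "F \<subseteq> I"
  shows "(\<Sum>i\<in>F. (cmod (cinner (e i) x))\<^sup>2) \<le> (norm x)\<^sup>2"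
proof -
  define y where "y = (\<Sum>i\<in>F. cinner (e i) x *\<^sub>C e i)"
  have "cinner y (x - y) = 0"
    by (subst (1) y_def)
      (simp add: cinner_sum_left cinner_scaleC_left y_def cinner_orthonormal_residual[OF e F])
  then have "(norm x)\<^sup>2 = (norm y)\<^sup>2 + (norm (x - y))\<^sup>2"
    using norm_add_sq[of y "x - y"] by simp
  then show ?thesis
    using norm_sq_orthonormal_sum[OF e F, of "\<lambda>i. cinner (e i) x"] by (simp add: y_def)
qed

text \<open>The operator sends \<open>x\<close> to the series of the \<open>f n\<close> with
  coefficients \<open>cinner (e n) x\<close>. Bessel's inequality gives both convergence of the
  series and the operator bound 1.\<close>

lemma exists_operator_on_orthonormal:
  fixes e f :: "nat \<Rightarrow> 'h::complex_hilbert"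
  assumes e: "orthonormal UNIV e" and f: "orthonormal UNIV f"
  shows "\<exists>U\<in>carrier BH. \<forall>n. U (e n) = f n"
proof -
  define u where "u x n = cinner (e n) x *\<^sub>C f n" for x n
  define U where "U x = (\<Sum>n. u x n)" for x
  have nu: "(norm (\<Sum>n\<in>F. u x n))\<^sup>2 = (\<Sum>n\<in>F. (cmod (cinner (e n) x))\<^sup>2)" if "finite F" for F x
    unfolding u_def using norm_sq_orthonormal_sum[OF f that] by simp
  have sm: "summable (u x)" for x
  proof -
    have "summable (\<lambda>n. (cmod (cinner (e n) x))\<^sup>2)"
      by (rule summableI_nonneg_bounded[where x="(norm x)\<^sup>2"])
        (auto intro: bessel_inequality[OF e])
    \<comment> \<open>By \<open>nu\<close> the squared norm of a block of the vector series is a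
      block of this scalar series, so the Cauchy criterion carries over.\<close>
    then have C: "\<exists>N. \<forall>m\<ge>N. \<forall>n. norm (\<Sum>k\<in>{m..<n}. (cmod (cinner (e k) x))\<^sup>2) < d" if "d > 0" for d
      using that unfolding summable_Cauchy by blast
    show ?thesis
      unfolding summable_Cauchy
    proof (intro allI impI)
      fix d :: real assume d: "d > 0"
      then obtain N where N: "\<And>m n. m \<ge> N \<Longrightarrow> norm (\<Sum>k\<in>{m..<n}. (cmod (cinner (e k) x))\<^sup>2) < d\<^sup>2"
        using C[of "d\<^sup>2"] by auto
      have "norm (sum (u x) {m..<n}) < d" if "m \<ge> N" for m n
        using N[OF that, of n] nu[of "{m..<n}" x] d
        by (intro power2_less_imp_less[of _ d]) auto
      then show "\<exists>N. \<forall>m\<ge>N. \<forall>n. norm (sum (u x) {m..<n}) < d" by blast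
    qed
  qed
  have add: "U (x + y) = U x + U y" for x y
  proof -
    have "u (x + y) = (\<lambda>n. u x n + u y n)"
      by (simp add: u_def fun_eq_iff cinner_add_right scaleC_add_left)
    then show ?thesis by (simp add: U_def suminf_add[OF sm sm])
  qed
  have sc: "U (c *\<^sub>C x) = c *\<^sub>C U x" for c x
  proof -
    have "u (c *\<^sub>C x) = (\<lambda>n. c *\<^sub>C u x n)"
      by (simp add: u_def fun_eq_iff cinner_scaleC_right scaleC_scaleC)
    then show ?thesis by (simp add: U_def bounded_linear.suminf[OF bl_scaleC sm])
  qed
  have bd: "norm (U x) \<le> norm x" for x
  proof (rule LIMSEQ_le_const2)
    show "(\<lambda>n. norm (\<Sum>i<n. u x i)) \<longlonglongrightarrow> norm (U x)"
      unfolding U_def by (intro tendsto_norm summable_LIMSEQ sm)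
    have "norm (\<Sum>i<n. u x i) \<le> norm x" for n
      by (rule power2_le_imp_le) (auto simp: nu intro: bessel_inequality[OF e])
    then show "\<exists>N. \<forall>n\<ge>N. norm (\<Sum>i<n. u x i) \<le> norm x" by blast
  qed
  have "U \<in> carrier BH"
    unfolding bop_carrier
    by (auto simp: sc add scaleR_scaleC bd intro!: bounded_linear_intro[where K=1])
  moreover have "U (e n) = f n" for n
  proof -
    have "U (e n) = (\<Sum>k\<in>{n}. u (e n) k)"
      unfolding U_def by (rule suminf_finite) (auto simp: u_def orthonormalD[OF e])
    then show ?thesis by (simp add: u_def orthonormalD[OF e])
  qed
  ultimately show ?thesis by blast
qed

text \<open>Totality says that only 0 is orthogonal to all \<open>e n\<close>, so it is applied to
  differences of adjoint values, whose inner products with \<open>e n\<close> involve only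
  \<open>S (e n)\<close> and \<open>T (e n)\<close>. Equal adjoints give equal operators.\<close>

lemma operator_eqI:
  fixes e :: "nat \<Rightarrow> 'h::complex_hilbert"
  assumes total: "\<forall>x. (\<forall>n. cinner x (e n) = 0) \<longrightarrow> x = 0"
    and S: "S \<in> carrier BH" and T: "T \<in> carrier BH" and eq: "\<And>n. S (e n) = T (e n)"
  shows "S = T"
proof (rule ext)
  fix x
  have "cadjoint S y = cadjoint T y" for y
  proof -
    have "cadjoint S y - cadjoint T y = 0"
      by (rule total[rule_format]) (simp add: cinner_diff_left adj_ex[OF S] adj_ex[OF T] eq)
    then show ?thesis by simp
  qed
  then have "cinner y (S x) = cinner y (T x)" for y
    by (metis adj_ex[OF S] adj_ex[OF T])
  then have "cinner (S x) y = cinner (T x) y" for y by (metis cinner_commute)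
  then show "S x = T x" by (rule cinner_ext)
qed

lemma operator_selfadjointI:
  fixes e :: "nat \<Rightarrow> 'h::complex_hilbert"
  assumes total: "\<forall>x. (\<forall>n. cinner x (e n) = 0) \<longrightarrow> x = 0"
    and S: "S \<in> carrier BH" and sym: "\<And>m n. cinner (S (e m)) (e n) = cinner (e m) (S (e n))"
  shows "cadjoint S = S"
proof (rule operator_eqI[OF total adj_carrier(1)[OF S] S])
  fix m
  have "cadjoint S (e m) - S (e m) = 0"
    by (rule total[rule_format]) (simp add: cinner_diff_left adj_ex[OF S] sym)
  then show "cadjoint S (e m) = S (e m)" by simp
qed

text \<open>A maximal orthonormal set from Zorn's lemma is total. It is infinite because a finite
  one would span the space, and countable by separability, so it can be enumerated by the natural
  numbers.\<close>

lemma exists_orthonormal_basis: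
  assumes sep: "separable_space (euclidean :: 'h::complex_hilbert topology)"
    and infdim: "\<nexists>B :: 'h::complex_hilbert set. finite B \<and> complex_vector.span B = UNIV"
  shows "\<exists>e :: nat \<Rightarrow> 'h. orthonormal UNIV e \<and> (\<forall>x. (\<forall>n. cinner x (e n) = 0) \<longrightarrow> x = 0)"
proof -
  obtain B :: "'h set" where B: "orthonormal B (\<lambda>b. b)"
    and max: "\<And>B'. orthonormal B' (\<lambda>b. b) \<Longrightarrow> B \<subseteq> B' \<Longrightarrow> B' = B"
  proof -
    have "\<exists>M\<in>{B :: 'h set. orthonormal B (\<lambda>b. b)}. \<forall>X\<in>{B. orthonormal B (\<lambda>b. b)}. M \<subseteq> X \<longrightarrow> X = M"
    proof (rule subset_Zorn')
      fix \<C> :: "'h set set" assume ch: "subset.chain {B. orthonormal B (\<lambda>b. b)} \<C>"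
      have "cinner x y = (if x = y then 1 else 0)" if "x \<in> \<Union>\<C>" "y \<in> \<Union>\<C>" for x y
      proof -
        obtain X Y where X: "X \<in> \<C>" "x \<in> X" "Y \<in> \<C>" "y \<in> Y" using \<open>x \<in> \<Union>\<C>\<close> \<open>y \<in> \<Union>\<C>\<close> by blast
        then have "X \<subseteq> Y \<or> Y \<subseteq> X" using ch by (auto simp: subset_chain_def)
        then obtain Z where "Z \<in> \<C>" "x \<in> Z" "y \<in> Z" using X by blast
        then show ?thesis using ch orthonormalD[of Z "\<lambda>b. b" x y] by (auto simp: subset_chain_def)
      qed
      then show "\<Union>\<C> \<in> {B. orthonormal B (\<lambda>b. b)}" by (simp add: orthonormal_def)
    qed
    then show ?thesis using that by blast
  qed
  have total: "x = 0" if x: "\<And>b. b \<in> B \<Longrightarrow> cinner b x = 0" for x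
  proof (rule ccontr)
    assume x0: "x \<noteq> 0"
    define y where "y = complex_of_real (1 / norm x) *\<^sub>C x"
    have ny: "norm y = 1" using x0 by (simp add: y_def norm_scaleC norm_divide)
    have b_y: "cinner b y = 0" if "b \<in> B" for b using x[OF that] by (simp add: y_def cinner_scaleC_right)
    have y_b: "cinner y b = 0" if "b \<in> B" for b using b_y[OF that] cinner_commute[of y b] by simp
    have "y \<notin> B" using b_y[of y] ny by (auto simp: cinner_self)
    moreover have "orthonormal (insert y B) (\<lambda>b. b)"
      using B b_y y_b ny \<open>y \<notin> B\<close> unfolding orthonormal_def by (auto simp: cinner_self)
    ultimately show False using max[of "insert y B"] by blast
  qed
  have "infinite B"
  proof
    assume fin: "finite B"
    have "x \<in> complex_vector.span B" for x
    proof -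
      \<comment> \<open>The residual of a finite expansion is orthogonal to all of \<open>B\<close>,
        hence 0 by totality.\<close>
      have "x - (\<Sum>b\<in>B. cinner b x *\<^sub>C b) = 0"
        using cinner_orthonormal_residual[OF B fin subset_refl, of _ x] by (intro total) auto
      then have "x = (\<Sum>b\<in>B. cinner b x *\<^sub>C b)" by simp
      moreover have "(\<Sum>b\<in>B. cinner b x *\<^sub>C b) \<in> complex_vector.span B"
        by (intro complex_vector.span_sum complex_vector.span_scale complex_vector.span_base)
      ultimately show ?thesis by metis
    qed
    then show False using fin infdim by blast
  qed
  moreover have "countable B"
  proof -
    obtain D :: "'h set" where D: "countable D" "closure D = UNIV"
      using sep unfolding separable_space_def by auto
    \<comment> \<open>Distinct members of \<open>B\<close> have squared distance 2, while two
      members with the same approximant would be at distance less than 1. So choosing approximants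
      within 1/2 is injective on \<open>B\<close>.\<close>
    have "\<exists>d\<in>D. dist d b < 1/2" for b
      using D(2) closure_approachable[of b D] by (metis UNIV_I half_gt_zero zero_less_one)
    then obtain d where d: "\<And>b. d b \<in> D" "\<And>b. dist (d b) b < 1/2" by metis
    have "inj_on d B"
    proof (rule inj_onI, rule ccontr)
      fix b c assume bc: "b \<in> B" "c \<in> B" "d b = d c" "b \<noteq> c"
      have "norm b = 1" "norm c = 1"
      proof -
        have "complex_of_real ((norm x)\<^sup>2) = 1" if "x \<in> B" for x
          using orthonormalD[OF B that that] by (simp add: cinner_self)
        then have "norm x = 1" if "x \<in> B" for x
          using that by (metis of_real_eq_1_iff power2_eq_1_iff abs_norm_cancel abs_1 abs_minus_cancel)
        then show "norm b = 1" "norm c = 1" using bc by auto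
      qed
      moreover have "cinner b c = 0" using orthonormalD[OF B bc(1,2)] bc(4) by simp
      ultimately have "(norm (b - c))\<^sup>2 = 2"
        using norm_add_sq[of b "- c"] by (simp add: cinner_minus_right)
      moreover have "norm (b - c) < 1"
        using dist_triangle3[of b c "d b"] d(2)[of b] d(2)[of c] bc(3) by (simp add: dist_norm)
      then have "(norm (b - c))\<^sup>2 < 1" by (simp add: abs_square_less_1)
      ultimately show False by simp
    qed
    then show ?thesis using D(1) d(1) by (meson countable_image_inj_on countable_subset image_subsetI)
  qed
  ultimately have bij: "bij_betw (from_nat_into B) UNIV B" by (intro bij_betw_from_nat_into)
  define e where "e = from_nat_into B"
  have eB: "e n \<in> B" and inj: "e m = e n \<longleftrightarrow> m = n" for m n
    using bij by (auto simp: e_def bij_betw_def inj_on_def)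
  have "orthonormal UNIV e" using orthonormalD[OF B eB eB] inj by (simp add: orthonormal_def)
  moreover have "x = 0" if x: "\<forall>n. cinner x (e n) = 0" for x
  proof (rule total)
    fix b assume "b \<in> B"
    then obtain n where "b = e n" using bij unfolding bij_betw_def e_def by blast
    then show "cinner b x = 0" using x cinner_commute[of b x] by simp
  qed
  ultimately show ?thesis by blast
qed

section \<open>Pauli operators on binary digits\<close>

lemma exists_spin_system:
  assumes sep: "separable_space (euclidean :: 'h::complex_hilbert topology)"
    and infdim: "\<nexists>B :: 'h::complex_hilbert set. finite B \<and> complex_vector.span B = UNIV"
  obtains s t :: "nat \<Rightarrow> 'h::complex_hilbert \<Rightarrow> 'h"
  where "\<And>n. s n \<in> carrier BH" "\<And>n. cadjoint (s n) = s n" "\<And>n. s n \<circ> s n = id"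
    and "\<And>n. t n \<in> carrier BH" "\<And>n. cadjoint (t n) = t n" "\<And>n. t n \<circ> t n = id"
    and "\<And>m n. s m \<circ> s n = s n \<circ> s m" "\<And>m n. t m \<circ> t n = t n \<circ> t m"
    and "\<And>m n. m \<noteq> n \<Longrightarrow> s m \<circ> t n = t n \<circ> s m"
    and "\<And>n. s n \<circ> t n = (\<lambda>x. (-1) *\<^sub>C (t n \<circ> s n) x)"
proof -
  obtain e :: "nat \<Rightarrow> 'h" where e: "orthonormal UNIV e"
    and total: "\<forall>x. (\<forall>n. cinner x (e n) = 0) \<longrightarrow> x = 0"
    using exists_orthonormal_basis[OF sep infdim] by blast
  have ee: "cinner (e i) (e j) = (if i = j then 1 else 0)" for i j
    using orthonormalD[OF e] by simp
  \<comment> \<open>The eigenvalue of \<open>s k\<close> at \<open>e n\<close> is read off the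
    \<open>k\<close>-th binary digit of \<open>n\<close>; \<open>t k\<close> will permute the basis
    by flipping that digit.\<close>
  define \<sigma> :: "nat \<Rightarrow> nat \<Rightarrow> complex" where "\<sigma> k n = (if bit n k then -1 else 1)" for k n
  have \<sigma>\<sigma>: "\<sigma> k n * \<sigma> k n = 1" "cnj (\<sigma> k n) = \<sigma> k n" for k n by (simp_all add: \<sigma>_def)
  have flip: "flip_bit k (flip_bit k n) = n" "flip_bit k (flip_bit l n) = flip_bit l (flip_bit k n)"
    for k l n :: nat
    by (rule bit_eqI; auto simp: bit_flip_bit_iff)+
  \<comment> \<open>The only source of signs: flipping digit \<open>l\<close> changes the eigenvalue
    for digit \<open>k\<close> exactly when \<open>k = l\<close>. On basis vectors this gives both
    the anticommutation and the commutation relations between \<open>s\<close> and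
    \<open>t\<close>.\<close>
  have \<sigma>flip: "\<sigma> k (flip_bit l n) = (if k = l then -1 else 1) * \<sigma> k n" for k l n
    by (simp add: \<sigma>_def bit_flip_bit_iff)
  have flip_inj: "flip_bit k m = flip_bit k n \<longleftrightarrow> m = n" for k m n :: nat
    using flip(1) by metis
  have "\<exists>U\<in>carrier BH. \<forall>n. U (e n) = \<sigma> k n *\<^sub>C e n" for k
    by (rule exists_operator_on_orthonormal[OF e])
      (simp add: orthonormal_def cinner_scaleC_left cinner_scaleC_right ee \<sigma>\<sigma>)
  then obtain s where s: "\<And>k. s k \<in> carrier BH" "\<And>k n. s k (e n) = \<sigma> k n *\<^sub>C e n" by metis
  have "\<exists>U\<in>carrier BH. \<forall>n. U (e n) = e (flip_bit k n)" for k
    by (rule exists_operator_on_orthonormal[OF e]) (simp add: orthonormal_def ee flip_inj)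
  then obtain t where t: "\<And>k. t k \<in> carrier BH" "\<And>k n. t k (e n) = e (flip_bit k n)" by metis
  note c = bop_closed(1)[OF s(1) s(1)] bop_closed(1)[OF s(1) t(1)] bop_closed(1)[OF t(1) s(1)]
    bop_closed(1)[OF t(1) t(1)] bop_closed(5)
  note eval_simps = s(2) t(2) bop_c[OF s(1)] bop_c[OF t(1)] scaleC_scaleC \<sigma>\<sigma> flip(1) \<sigma>flip
  show ?thesis
  proof
    show "s n \<in> carrier BH" "t n \<in> carrier BH" for n by (fact s(1) t(1))+
    show "cadjoint (s k) = s k" for k
      by (rule operator_selfadjointI[OF total s(1)])
        (simp add: s(2) cinner_scaleC_left cinner_scaleC_right \<sigma>\<sigma> ee)
    show "cadjoint (t k) = t k" for k
      by (rule operator_selfadjointI[OF total t(1)]) (use flip(1) in \<open>auto simp: t(2) ee\<close>)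
    show "s n \<circ> s n = id" "t n \<circ> t n = id" for n
      by (rule operator_eqI[OF total]; (rule c)?; simp add: eval_simps)+
    show "s m \<circ> s n = s n \<circ> s m" for m n
      by (rule operator_eqI[OF total]; (rule c)?; simp add: eval_simps mult.commute)
    show "t m \<circ> t n = t n \<circ> t m" for m n
      by (rule operator_eqI[OF total]; (rule c)?; simp add: t(2) flip(2)[of m n])
    show "s m \<circ> t n = t n \<circ> s m" if "m \<noteq> n" for m n
      by (rule operator_eqI[OF total]; (rule c)?; simp add: eval_simps that)
    show "s n \<circ> t n = (\<lambda>x. (-1) *\<^sub>C (t n \<circ> s n) x)" for n
      by (rule operator_eqI[OF total]; (rule c bop_closed(3)[OF c(3)])?; simp add: eval_simps)
  qed
qed

theorem mainTheorem1:
  fixes M :: "('m, 'r) star_algebra_scheme"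
    and \<phi> :: "('h::complex_hilbert \<Rightarrow> 'h) \<Rightarrow> 'm"
  assumes separable: "separable_space (euclidean :: 'h topology)"
    and infinite_dimensional: "\<nexists>B :: 'h set. finite B \<and> complex_vector.span B = UNIV"
    and awstar: "awstar_algebra M"
    and discretization: "discretization (bounded_operators :: ('h \<Rightarrow> 'h) star_algebra) M \<phi>"
  shows "carrier M = {\<zero>\<^bsub>M\<^esub>}"
proof -
  obtain s t :: "nat \<Rightarrow> 'h \<Rightarrow> 'h"
    where st: "\<And>n. s n \<in> carrier BH" "\<And>n. cadjoint (s n) = s n" "\<And>n. s n \<circ> s n = id"
      "\<And>n. t n \<in> carrier BH" "\<And>n. cadjoint (t n) = t n" "\<And>n. t n \<circ> t n = id"
      "\<And>m n. s m \<circ> s n = s n \<circ> s m" "\<And>m n. t m \<circ> t n = t n \<circ> t m"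
      "\<And>m n. m \<noteq> n \<Longrightarrow> s m \<circ> t n = t n \<circ> s m"
      "\<And>n. s n \<circ> t n = (\<lambda>x. (-1) *\<^sub>C (t n \<circ> s n) x)"
    by (rule exists_spin_system[OF separable infinite_dimensional], rule that)
  show ?thesis
    \<comment> \<open>Unfolding \<open>bop_simps\<close> turns the abstract algebra operations into
      composition, \<open>cadjoint\<close> and pointwise scaling, the form in which the spin
      relations are given.\<close>
    by (rule discretization_zero_of_spins[OF discretization, of s t], unfold bop_simps) (fact st)+
qed

end
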